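(* Let $X\in G$ and $Y,Z\in USS(X)$ with $\ell(Y)>0$. Then there is an oriented path $(b_1,\ldots,b_t,g_1,\ldots,g_s)$ in $\Gamma_X$ from $Y$ to $Z$ such that $(b_1,\ldots,b_t)$ is a (possibly empty) black path and $(g_1,\ldots,g_s)$ is a (possibly empty) grey path. Moreover, if $Z=Y^\alpha$ with $\alpha\in P$, the path can be chosen so that $b_1\cdots b_t g_1\cdots g_s=\alpha$.
   Context: $G$ is a Garside group: it has a lattice order $\preccurlyeq$ invariant under left multiplication ($a\preccurlyeq b$ iff $a^{-1}b\in P$, where $P=\{p\in G:1\preccurlyeq p\}$), with meet $\wedge$; there is a Garside element $\Delta\in P$ such that $[1,\Delta]$ is finite and generates $G$ and $\Delta^{-1}P\Delta=P$; and $P$ is atomic. Elements of $[1,\Delta]$ are simple. $\tau(x)=\Delta^{-1}x\Delta$; $X^a=a^{-1}Xa$. Left normal form $X=\Delta^p x_1\cdots x_r$: $p$ maximal with $\Delta^p\preccurlyeq X$, each $x_i\neq 1$ the maximal simple prefix of $x_i\cdots x_r$; $\inf X=p$, $\sup X=p+r$, $\ell(X)=r$. $\iota(X)=\tau^{-p}(x_1)$ if $r>0$, $\iota(\Delta^p)=1$. $\mathbf c(X)=X^{\iota(X)}$. $SSS(X)$: conjugates of $X$ of maximal infimum and minimal supremum; $USS(X)$: those $Y\in SSS(X)$ with $\mathbf c^m(Y)=Y$ for some $m>0$. A minimal simple element for $Y\in USS(X)$ is a simple $s\neq1$ with $Y^s\in USS(X)$ such that no prefix $t\ne1$, $t\neq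 s$ of $s$ has $Y^t\in USS(X)$. $\Gamma_X$ is the directed graph with vertex set $USS(X)$ and an arrow labeled $s$ from $Y$ to $Y^s$ for each $Y\in USS(X)$ and each minimal simple element $s$ for $Y$. An arrow $s$ starting at $Y$ is black if $s\preccurlyeq\iota(Y)$ and grey if $s\preccurlyeq\iota(Y^{-1})$. An oriented path is a sequence of arrows, each starting at the endpoint of the previous one; it is black (grey) if all its arrows are black (grey). *)

theory Defs
  imports "HOL-Algebra.Generated_Groups"
begin

definition prec :: "('a,'b) monoid_scheme \<Rightarrow> 'a set \<Rightarrow> 'a \<Rightarrow> 'a \<Rightarrow> bool" where
  "prec G P a b \<longleftrightarrow> a \<in> carrier G \<and> b \<in> carrier G \<and> inv\<^bsub>G\<^esub> a \<otimes>\<^bsub>G\<^esub> b \<in> P"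

definition is_meet :: "('a,'b) monoid_scheme \<Rightarrow> 'a set \<Rightarrow> 'a \<Rightarrow> 'a \<Rightarrow> 'a \<Rightarrow> bool" where
  "is_meet G P a b m \<longleftrightarrow> prec G P m a \<and> prec G P m b \<and>
     (\<forall>c. prec G P c a \<and> prec G P c b \<longrightarrow> prec G P c m)"

definition is_join :: "('a,'b) monoid_scheme \<Rightarrow> 'a set \<Rightarrow> 'a \<Rightarrow> 'a \<Rightarrow> 'a \<Rightarrow> bool" where
  "is_join G P a b j \<longleftrightarrow> prec G P a j \<and> prec G P b j \<and>
     (\<forall>c. prec G P a c \<and> prec G P b c \<longrightarrow> prec G P j c)"

definition simples :: "('a,'b) monoid_scheme \<Rightarrow> 'a set \<Rightarrow> 'a \<Rightarrow> 'a set" where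
  "simples G P D = {s. prec G P \<one>\<^bsub>G\<^esub> s \<and> prec G P s D}"

definition atomic :: "('a,'b) monoid_scheme \<Rightarrow> 'a set \<Rightarrow> bool" where
  "atomic G P \<longleftrightarrow> (\<forall>x\<in>P. \<exists>N::nat. \<forall>xs.
     (\<forall>a\<in>set xs. a \<in> P \<and> a \<noteq> \<one>\<^bsub>G\<^esub>) \<and> foldr (\<otimes>\<^bsub>G\<^esub>) xs \<one>\<^bsub>G\<^esub> = x
       \<longrightarrow> length xs \<le> N)"

definition garside :: "('a,'b) monoid_scheme \<Rightarrow> 'a set \<Rightarrow> 'a \<Rightarrow> bool" where
  "garside G P D \<longleftrightarrow> group G \<and> P \<subseteq> carrier G \<and>
     \<comment> \<open>\<preccurlyeq> is a partial order\<close>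
     (\<forall>a\<in>carrier G. prec G P a a) \<and>
     (\<forall>a b. prec G P a b \<and> prec G P b a \<longrightarrow> a = b) \<and>
     (\<forall>a b c. prec G P a b \<and> prec G P b c \<longrightarrow> prec G P a c) \<and>
     \<comment> \<open>lattice\<close>
     (\<forall>a\<in>carrier G. \<forall>b\<in>carrier G. (\<exists>m. is_meet G P a b m) \<and> (\<exists>j. is_join G P a b j)) \<and>
     \<comment> \<open>Garside element\<close>
     D \<in> P \<and> finite (simples G P D) \<and> generate G (simples G P D) = carrier G \<and>
     {inv\<^bsub>G\<^esub> D \<otimes>\<^bsub>G\<^esub> p \<otimes>\<^bsub>G\<^esub> D | p. p \<in> P} = P \<and>
     atomic G P"

definition conjg :: "('a,'b) monoid_scheme \<Rightarrow> 'a \<Rightarrow> 'a \<Rightarrow> 'a" where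
  "conjg G X a = inv\<^bsub>G\<^esub> a \<otimes>\<^bsub>G\<^esub> X \<otimes>\<^bsub>G\<^esub> a"

definition ginf :: "('a,'b) monoid_scheme \<Rightarrow> 'a set \<Rightarrow> 'a \<Rightarrow> 'a \<Rightarrow> int" where
  "ginf G P D X = (GREATEST p::int. prec G P (D [^]\<^bsub>G\<^esub> p) X)"

definition gsup :: "('a,'b) monoid_scheme \<Rightarrow> 'a set \<Rightarrow> 'a \<Rightarrow> 'a \<Rightarrow> int" where
  "gsup G P D X = (LEAST p::int. prec G P X (D [^]\<^bsub>G\<^esub> p))"

definition glen :: "('a,'b) monoid_scheme \<Rightarrow> 'a set \<Rightarrow> 'a \<Rightarrow> 'a \<Rightarrow> int" where
  "glen G P D X = gsup G P D X - ginf G P D X"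

definition max_simple_prefix :: "('a,'b) monoid_scheme \<Rightarrow> 'a set \<Rightarrow> 'a \<Rightarrow> 'a \<Rightarrow> 'a" where
  "max_simple_prefix G P D W = (THE s. s \<in> simples G P D \<and> prec G P s W \<and>
      (\<forall>t. t \<in> simples G P D \<and> prec G P t W \<longrightarrow> prec G P t s))"

text \<open>Initial factor: iota(X) = tau^-p(x_1) = D^p x_1 D^-p, where x_1 is the
  maximal simple prefix of D^-p X, p = inf X; iota(D^p) = 1.\<close>
definition iota :: "('a,'b) monoid_scheme \<Rightarrow> 'a set \<Rightarrow> 'a \<Rightarrow> 'a \<Rightarrow> 'a" where
  "iota G P D X = (let p = ginf G P D X in
     if glen G P D X > 0 then
       D [^]\<^bsub>G\<^esub> p \<otimes>\<^bsub>G\<^esub>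
         max_simple_prefix G P D (D [^]\<^bsub>G\<^esub> (-p) \<otimes>\<^bsub>G\<^esub> X)
         \<otimes>\<^bsub>G\<^esub> D [^]\<^bsub>G\<^esub> (-p)
     else \<one>\<^bsub>G\<^esub>)"

definition cycling :: "('a,'b) monoid_scheme \<Rightarrow> 'a set \<Rightarrow> 'a \<Rightarrow> 'a \<Rightarrow> 'a" where
  "cycling G P D X = conjg G X (iota G P D X)"

definition conjugates :: "('a,'b) monoid_scheme \<Rightarrow> 'a \<Rightarrow> 'a set" where
  "conjugates G X = {conjg G X a | a. a \<in> carrier G}"

definition SSS :: "('a,'b) monoid_scheme \<Rightarrow> 'a set \<Rightarrow> 'a \<Rightarrow> 'a \<Rightarrow> 'a set" where
  "SSS G P D X = {Y \<in> conjugates G X. \<forall>Z \<in> conjugates G X.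
      ginf G P D Z \<le> ginf G P D Y \<and> gsup G P D Y \<le> gsup G P D Z}"

definition USS :: "('a,'b) monoid_scheme \<Rightarrow> 'a set \<Rightarrow> 'a \<Rightarrow> 'a \<Rightarrow> 'a set" where
  "USS G P D X = {Y \<in> SSS G P D X. \<exists>m>0. (cycling G P D ^^ m) Y = Y}"

definition minimal_simple :: "('a,'b) monoid_scheme \<Rightarrow> 'a set \<Rightarrow> 'a \<Rightarrow> 'a \<Rightarrow> 'a \<Rightarrow> 'a \<Rightarrow> bool" where
  "minimal_simple G P D X Y s \<longleftrightarrow> s \<in> simples G P D \<and> s \<noteq> \<one>\<^bsub>G\<^esub> \<and>
     conjg G Y s \<in> USS G P D X \<and>
     (\<nexists>t. prec G P t s \<and> t \<noteq> \<one>\<^bsub>G\<^esub> \<and> t \<noteq> s \<and> prec G P \<one>\<^bsub>G\<^esub> t \<and> conjg G Y t \<in> USS G P D X)"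

text \<open>Arrow s from Y (a vertex of Gamma_X) to Y^s.\<close>
definition arrow :: "('a,'b) monoid_scheme \<Rightarrow> 'a set \<Rightarrow> 'a \<Rightarrow> 'a \<Rightarrow> 'a \<Rightarrow> 'a \<Rightarrow> bool" where
  "arrow G P D X Y s \<longleftrightarrow> Y \<in> USS G P D X \<and> minimal_simple G P D X Y s"

definition black_arrow :: "('a,'b) monoid_scheme \<Rightarrow> 'a set \<Rightarrow> 'a \<Rightarrow> 'a \<Rightarrow> 'a \<Rightarrow> 'a \<Rightarrow> bool" where
  "black_arrow G P D X Y s \<longleftrightarrow> arrow G P D X Y s \<and> prec G P s (iota G P D Y)"

definition grey_arrow :: "('a,'b) monoid_scheme \<Rightarrow> 'a set \<Rightarrow> 'a \<Rightarrow> 'a \<Rightarrow> 'a \<Rightarrow> 'a \<Rightarrow> bool" where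
  "grey_arrow G P D X Y s \<longleftrightarrow> arrow G P D X Y s \<and> prec G P s (iota G P D (inv\<^bsub>G\<^esub> Y))"

fun path_by :: "('a \<Rightarrow> 'a \<Rightarrow> bool) \<Rightarrow> ('a,'b) monoid_scheme \<Rightarrow> 'a set \<Rightarrow> 'a \<Rightarrow> 'a \<Rightarrow> 'a \<Rightarrow> 'a list \<Rightarrow> 'a \<Rightarrow> bool" where
  "path_by A G P D X Y [] Z \<longleftrightarrow> Y \<in> USS G P D X \<and> Y = Z"
| "path_by A G P D X Y (s # ss) Z \<longleftrightarrow> A Y s \<and> path_by A G P D X (conjg G Y s) ss Z"

definition black_path where
  "black_path G P D X = path_by (black_arrow G P D X) G P D X"

definition grey_path where
  "grey_path G P D X = path_by (grey_arrow G P D X) G P D X"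

end

theory Submission
  imports Defs
begin

text \<open>Conjugation by the initial factor is natural for positive conjugators inside the super summit
  set, so these can be transported along cycling, and the transport preserves meets. On the ultra
  summit set the transport is periodic. Hence the conjugators leading from one element to others of
  the ultra summit set are closed under meets, and every minimal simple element \<open>s\<close> for \<open>Y\<close> is a
  prefix of the initial factor of \<open>Y\<close> or of \<open>Y\<^sup>-\<^sup>1\<close>.

  Given \<open>\<alpha>\<close>, strip off black arrows until the remaining \<open>\<beta>\<close>, starting at \<open>W\<close>, has trivial meet
  with \<open>W \<Delta>\<^sup>-\<^sup>p\<close>. Then every factorisation of \<open>\<beta>\<close> into minimal simple elements is grey: as long as
  the arrows are grey, their product \<open>x\<close> is a prefix of \<open>W\<^sup>-\<^sup>k \<Delta>\<^sup>k\<^sup>q\<close> for some \<open>k\<close>, and a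
  non-grey arrow \<open>c\<close> following \<open>x\<close> would force \<open>x c\<close> to have a nontrivial common prefix with
  \<open>W \<Delta>\<^sup>-\<^sup>p\<close>.\<close>

section \<open>Periodicity of injective self-maps of finite sets\<close>

lemma funpow_mult_fixed: "(f ^^ m) x = x \<Longrightarrow> (f ^^ (m * n)) x = x"
  by (induction n) (simp_all add: funpow_add)

text \<open>The restrictions of the iterates to \<open>S\<close> lie in a finite function space, so
  two of them coincide, and injectivity cancels the smaller exponent. The free factor
  \<open>k\<close> later provides multiples of the period beyond a given bound.\<close>

lemma finite_inj_self_map_periodic:
  assumes fin: "finite S" and inj: "inj_on f S" and into: "f ` S \<subseteq> S"
  obtains N :: nat where "N > 0" "\<And>x k. x \<in> S \<Longrightarrow> (f ^^ (N * k)) x = x"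
proof -
  have into_n: "(f ^^ n) x \<in> S" if "x \<in> S" for n x
    using that into by (induction n) auto
  have inj_n: "x = y" if "(f ^^ n) x = (f ^^ n) y" "x \<in> S" "y \<in> S" for n x y
    using that
  proof (induction n)
    case (Suc n)
    then have "(f ^^ n) x = (f ^^ n) y"
      using inj into_n by (simp add: inj_on_eq_iff)
    then show ?case using Suc by blast
  qed simp
  define r where "r n = restrict (f ^^ n) S" for n
  have "range r \<subseteq> S \<rightarrow>\<^sub>E S"
    using into_n by (auto simp: r_def)
  moreover have "finite (S \<rightarrow>\<^sub>E S)"
    using fin by (simp add: finite_PiE)
  ultimately have "finite (range r)"
    by (rule finite_subset)
  then have "\<not> inj r"
    using finite_imageD infinite_UNIV_nat by blast
  then obtain i j where ij: "i < j" "r i = r j"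
    unfolding inj_def by (metis linorder_neqE_nat)
  have per: "(f ^^ (j - i)) x = x" if x: "x \<in> S" for x
  proof -
    have "(f ^^ i) x = (f ^^ j) x"
      using ij(2) x unfolding r_def by (metis restrict_apply')
    also have "\<dots> = (f ^^ i) ((f ^^ (j - i)) x)"
      using ij(1) by (metis add_diff_inverse_nat comp_apply funpow_add less_imp_le not_le)
    finally show ?thesis
      using inj_n x into_n by metis
  qed
  then show thesis
    using that[of "j - i"] ij(1) funpow_mult_fixed by fastforce
qed

subsection \<open>Garside groups\<close>

locale garside_group =
  fixes G :: "('a, 'b) monoid_scheme" (structure) and P :: "'a set" and D :: 'a
  assumes garside: "garside G P D"

sublocale garside_group \<subseteq> group G
  using garside by (simp add: garside_def)

context garside_group
begin

abbreviation le (infix "\<preceq>" 50) where "a \<preceq> b \<equiv> prec G P a b"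

abbreviation cj where "cj V x \<equiv> conjg G V x"

definition glb where "glb a b = (THE m. is_meet G P a b m)"
definition lub where "lub a b = (THE m. is_join G P a b m)"

lemma P_carrier [simp]: "x \<in> P \<Longrightarrow> x \<in> carrier G"
  using garside by (auto simp: garside_def)

lemma le_carrier: "a \<preceq> b \<Longrightarrow> a \<in> carrier G" "a \<preceq> b \<Longrightarrow> b \<in> carrier G"
  by (auto simp: prec_def)

lemma le_refl [simp]: "a \<in> carrier G \<Longrightarrow> a \<preceq> a"
  using garside by (simp add: garside_def)

lemma le_antisym: "a \<preceq> b \<Longrightarrow> b \<preceq> a \<Longrightarrow> a = b"
  using garside unfolding garside_def by blast

lemma le_trans [trans]: "a \<preceq> b \<Longrightarrow> b \<preceq> c \<Longrightarrow> a \<preceq> c"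
  using garside unfolding garside_def by blast

lemma one_le_iff: "\<one> \<preceq> a \<longleftrightarrow> a \<in> P"
  by (auto simp: prec_def)

lemma one_in_P [simp]: "\<one> \<in> P"
  using le_refl[of \<one>] by (simp add: one_le_iff)

lemma D_in_P [simp]: "D \<in> P"
  using garside by (simp add: garside_def)

lemma D_carrier [simp]: "D \<in> carrier G"
  by simp

lemma inv_mult_cancel_left [simp]:
  assumes "x \<in> carrier G" "y \<in> carrier G"
  shows "inv x \<otimes> (x \<otimes> y) = y" "x \<otimes> (inv x \<otimes> y) = y"
  using assms by (simp_all add: m_assoc[symmetric])

lemma D_pow_mult [simp]: "D [^] (i::int) \<otimes> D [^] (j::int) = D [^] (i + j)"
  by (simp add: int_pow_mult)

lemma D_pow_mult_left [simp]:
  "x \<in> carrier G \<Longrightarrow> D [^] (i::int) \<otimes> (D [^] (j::int) \<otimes> x) = D [^] (i + j) \<otimes> x"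
  by (simp add: m_assoc[symmetric])

lemma inv_D_pow [simp]: "inv (D [^] (i::int)) = D [^] (- i)"
  by (simp add: int_pow_neg)

lemma D_pow_one [simp]: "D [^] (1::int) = D"
  by (simp add: int_pow_1)

lemma D_mult_pow [simp]:
  "D \<otimes> D [^] (i::int) = D [^] (1 + i)" "D [^] i \<otimes> D = D [^] (i + 1)"
  "x \<in> carrier G \<Longrightarrow> D \<otimes> (D [^] i \<otimes> x) = D [^] (1 + i) \<otimes> x"
  "x \<in> carrier G \<Longrightarrow> D [^] i \<otimes> (D \<otimes> x) = D [^] (i + 1) \<otimes> x"
  using D_pow_mult[of 1 i] D_pow_mult[of i 1] D_pow_mult_left[of x 1 i] D_pow_mult_left[of x i 1]
  by simp_all

lemma le_mult_left_iff:
  "\<lbrakk>g \<in> carrier G; a \<in> carrier G; b \<in> carrier G\<rbrakk> \<Longrightarrow> g \<otimes> a \<preceq> g \<otimes> b \<longleftrightarrow> a \<preceq> b"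
  by (simp add: prec_def inv_mult_group m_assoc)

lemma le_mult_left: "g \<in> carrier G \<Longrightarrow> a \<preceq> b \<Longrightarrow> g \<otimes> a \<preceq> g \<otimes> b"
  using le_mult_left_iff le_carrier by metis

lemma le_mult_right: "a \<in> carrier G \<Longrightarrow> b \<in> P \<Longrightarrow> a \<preceq> a \<otimes> b"
  by (simp add: prec_def)

lemma mult_in_P [simp]: "a \<in> P \<Longrightarrow> b \<in> P \<Longrightarrow> a \<otimes> b \<in> P"
  using le_trans[of \<one> a "a \<otimes> b"] le_mult_right[of a b] by (simp add: one_le_iff)

lemma P_prefix: "a \<in> P \<Longrightarrow> a \<preceq> b \<Longrightarrow> b \<in> P"
  using le_trans one_le_iff by blast

lemma le_one_imp: "a \<in> P \<Longrightarrow> a \<preceq> \<one> \<Longrightarrow> a = \<one>"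
  using le_antisym one_le_iff by blast

lemma conj_D_in_P_iff:
  assumes "x \<in> carrier G"
  shows "inv D \<otimes> (x \<otimes> D) \<in> P \<longleftrightarrow> x \<in> P"
proof
  have eq: "{inv D \<otimes> p \<otimes> D | p. p \<in> P} = P"
    using garside unfolding garside_def by (elim conjE)
  show "inv D \<otimes> (x \<otimes> D) \<in> P" if "x \<in> P"
  proof -
    have "inv D \<otimes> x \<otimes> D \<in> {inv D \<otimes> p \<otimes> D | p. p \<in> P}" using that by blast
    then have "inv D \<otimes> x \<otimes> D \<in> P" by (simp only: eq)
    then show ?thesis using that by (simp add: m_assoc)
  qed
  assume "inv D \<otimes> (x \<otimes> D) \<in> P"
  then have "inv D \<otimes> (x \<otimes> D) \<in> {inv D \<otimes> p \<otimes> D | p. p \<in> P}"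
    by (simp only: eq)
  then obtain p where p: "p \<in> P" "inv D \<otimes> (x \<otimes> D) = inv D \<otimes> p \<otimes> D"
    by blast
  then have "inv D \<otimes> (x \<otimes> D) = inv D \<otimes> (p \<otimes> D)"
    by (simp add: m_assoc)
  then have "x = p" using p(1) assms by simp
  then show "x \<in> P" using p(1) by simp
qed

lemma conj_D_pow_in_P_iff:
  "x \<in> carrier G \<Longrightarrow> D [^] (- i :: int) \<otimes> (x \<otimes> D [^] i) \<in> P \<longleftrightarrow> x \<in> P"
proof (induction i arbitrary: x rule: int_induct[of _ 0])
  case base
  then show ?case by simp
next
  case (step1 i)
  have "D [^] (- (i + 1)) \<otimes> (x \<otimes> D [^] (i + 1)) = inv D \<otimes> ((D [^] (- i) \<otimes> (x \<otimes> D [^] i)) \<otimes> D)"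
    using step1.prems inv_D_pow[of 1] D_pow_mult_left[of _ "-1" "-i"]
    by (simp add: m_assoc algebra_simps)
  then show ?case using step1 conj_D_in_P_iff by simp
next
  case (step2 i)
  have "D [^] (- i) \<otimes> (x \<otimes> D [^] i) = inv D \<otimes> ((D [^] (- (i - 1)) \<otimes> (x \<otimes> D [^] (i - 1))) \<otimes> D)"
    using step2.prems inv_D_pow[of 1] D_pow_mult_left[of _ "-1" "1-i"]
    by (simp add: m_assoc)
  moreover have "D [^] (- (i - 1)) \<otimes> (x \<otimes> D [^] (i - 1)) \<in> carrier G"
    using step2.prems by simp
  ultimately show ?case using step2.IH[OF step2.prems] conj_D_in_P_iff by metis
qed

text \<open>Order invariance is built in on the left only; powers of \<open>D\<close> may also act
  on the right because conjugation by \<open>D\<close> maps \<open>P\<close> onto itself. Maps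
  sending \<open>x\<close> to \<open>g \<otimes> x \<otimes> D [^] i\<close> are thus order
  automorphisms.\<close>

lemma le_mult_D_pow_iff:
  "\<lbrakk>a \<in> carrier G; b \<in> carrier G\<rbrakk> \<Longrightarrow> a \<otimes> D [^] (i::int) \<preceq> b \<otimes> D [^] i \<longleftrightarrow> a \<preceq> b"
  using conj_D_pow_in_P_iff[of "inv a \<otimes> b" i] by (simp add: prec_def inv_mult_group m_assoc)

lemma le_mult_D_pow: "a \<preceq> b \<Longrightarrow> a \<otimes> D [^] (i::int) \<preceq> b \<otimes> D [^] i"
  using le_mult_D_pow_iff le_carrier by metis

section \<open>Meets and joins\<close>

lemma lattice:
  "\<forall>a\<in>carrier G. \<forall>b\<in>carrier G. (\<exists>m. is_meet G P a b m) \<and> (\<exists>j. is_join G P a b j)"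
  using garside unfolding garside_def by (elim conjE)

lemma atomic_P: "atomic G P"
  using garside by (simp add: garside_def)

lemma is_meet_glb: "\<lbrakk>a \<in> carrier G; b \<in> carrier G\<rbrakk> \<Longrightarrow> is_meet G P a b (glb a b)"
proof -
  assume "a \<in> carrier G" "b \<in> carrier G"
  then obtain m where m: "is_meet G P a b m"
    using lattice by blast
  then show ?thesis
    unfolding glb_def by (rule theI) (use m in \<open>auto simp: is_meet_def intro: le_antisym\<close>)
qed

lemma is_join_lub: "\<lbrakk>a \<in> carrier G; b \<in> carrier G\<rbrakk> \<Longrightarrow> is_join G P a b (lub a b)"
proof -
  assume "a \<in> carrier G" "b \<in> carrier G"
  then obtain m where m: "is_join G P a b m"
    using lattice by blast
  then show ?thesis
    unfolding lub_def by (rule theI) (use m in \<open>auto simp: is_join_def intro: le_antisym\<close>)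
qed

lemma glb_le1: "\<lbrakk>a \<in> carrier G; b \<in> carrier G\<rbrakk> \<Longrightarrow> glb a b \<preceq> a"
  and glb_le2: "\<lbrakk>a \<in> carrier G; b \<in> carrier G\<rbrakk> \<Longrightarrow> glb a b \<preceq> b"
  using is_meet_glb by (auto simp: is_meet_def)

lemma le_glb: "c \<preceq> a \<Longrightarrow> c \<preceq> b \<Longrightarrow> c \<preceq> glb a b"
  using is_meet_glb[of a b] le_carrier(2)[of c a] le_carrier(2)[of c b] by (auto simp: is_meet_def)

lemma glb_carrier [simp]: "\<lbrakk>a \<in> carrier G; b \<in> carrier G\<rbrakk> \<Longrightarrow> glb a b \<in> carrier G"
  by (rule glb_le1[THEN le_carrier(1)])

lemma glb_in_P [simp]: "\<lbrakk>a \<in> P; b \<in> P\<rbrakk> \<Longrightarrow> glb a b \<in> P"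
  using le_glb[of \<one> a b] by (simp add: one_le_iff)

lemma le_lub1: "\<lbrakk>a \<in> carrier G; b \<in> carrier G\<rbrakk> \<Longrightarrow> a \<preceq> lub a b"
  and le_lub2: "\<lbrakk>a \<in> carrier G; b \<in> carrier G\<rbrakk> \<Longrightarrow> b \<preceq> lub a b"
  using is_join_lub by (auto simp: is_join_def)

lemma lub_le: "a \<preceq> c \<Longrightarrow> b \<preceq> c \<Longrightarrow> lub a b \<preceq> c"
  using is_join_lub[of a b] le_carrier(1)[of a c] le_carrier(1)[of b c] by (auto simp: is_join_def)

lemma glb_eqI:
  assumes "m \<preceq> a" "m \<preceq> b" "\<And>c. c \<preceq> a \<Longrightarrow> c \<preceq> b \<Longrightarrow> c \<preceq> m"
  shows "glb a b = m"
  using assms glb_le1[of a b] glb_le2[of a b] le_glb[of m a b]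
    le_carrier(2)[of m a] le_carrier(2)[of m b] by (auto intro: le_antisym)

lemma glb_absorb: "a \<preceq> b \<Longrightarrow> glb a b = a"
  by (rule glb_eqI) (auto intro: le_carrier(1) le_refl)

lemma glb_mult_left:
  assumes "g \<in> carrier G" "a \<in> carrier G" "b \<in> carrier G"
  shows "glb (g \<otimes> a) (g \<otimes> b) = g \<otimes> glb a b"
proof (rule glb_eqI)
  fix c assume c: "c \<preceq> g \<otimes> a" "c \<preceq> g \<otimes> b"
  then have "inv g \<otimes> c \<preceq> a" "inv g \<otimes> c \<preceq> b"
    using assms c[THEN le_mult_left[of "inv g", rotated]] by simp_all
  then have "inv g \<otimes> c \<preceq> glb a b" by (rule le_glb)
  then have "g \<otimes> (inv g \<otimes> c) \<preceq> g \<otimes> glb a b" using assms(1) by (rule le_mult_left[rotated])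
  then show "c \<preceq> g \<otimes> glb a b" using assms c(1) by (simp add: le_carrier(1)[OF c(1)])
qed (use assms glb_le1 glb_le2 le_mult_left in auto)

lemma glb_mult_D_pow:
  assumes "a \<in> carrier G" "b \<in> carrier G"
  shows "glb (a \<otimes> D [^] (i::int)) (b \<otimes> D [^] i) = glb a b \<otimes> D [^] i"
proof (rule glb_eqI)
  fix c assume c: "c \<preceq> a \<otimes> D [^] i" "c \<preceq> b \<otimes> D [^] i"
  have cc: "c \<in> carrier G" using c(1) by (rule le_carrier)
  have "c \<otimes> D [^] (- i) \<preceq> a" "c \<otimes> D [^] (- i) \<preceq> b"
    using c[THEN le_mult_D_pow[of _ _ "- i"]] assms by (simp_all add: m_assoc)
  then have "c \<otimes> D [^] (- i) \<otimes> D [^] i \<preceq> glb a b \<otimes> D [^] i"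
    by (intro le_mult_D_pow le_glb)
  then show "c \<preceq> glb a b \<otimes> D [^] i" using cc by (simp add: m_assoc)
qed (use assms glb_le1 glb_le2 le_mult_D_pow in auto)

lemma conjg_closed [simp]: "\<lbrakk>V \<in> carrier G; x \<in> carrier G\<rbrakk> \<Longrightarrow> cj V x \<in> carrier G"
  by (simp add: conjg_def)

lemma conjg_mult: "\<lbrakk>V \<in> carrier G; x \<in> carrier G; y \<in> carrier G\<rbrakk> \<Longrightarrow> cj (cj V x) y = cj V (x \<otimes> y)"
  by (simp add: conjg_def inv_mult_group m_assoc)

lemma conjg_one [simp]: "V \<in> carrier G \<Longrightarrow> cj V \<one> = V"
  by (simp add: conjg_def)

section \<open>Bounds by powers of \<open>D\<close>, and induction on positive elements\<close>

lemma D_pow_le_mono: "i \<le> j \<Longrightarrow> D [^] (i::int) \<preceq> D [^] j"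
proof -
  assume "i \<le> j"
  have "D [^] (int n) \<in> P" for n
  proof (induction n)
    case (Suc n)
    then show ?case using mult_in_P[OF Suc D_in_P] by (simp del: mult_in_P add: add.commute)
  qed simp
  then have "D [^] (j - i) \<in> P" using \<open>i \<le> j\<close> by (metis diff_ge_0_iff_ge nonneg_int_cases)
  then show ?thesis by (simp add: prec_def add.commute)
qed

text \<open>Simple elements lie between \<open>\<one>\<close> and \<open>D\<close>, their inverses
  between \<open>D [^] (-1)\<close> and \<open>\<one>\<close>, and bounds of two factors multiply
  because powers of \<open>D\<close> may act on the right.\<close>

lemma D_pow_bounds:
  assumes "g \<in> carrier G"
  shows "\<exists>n. D [^] (- int n) \<preceq> g \<and> g \<preceq> D [^] (int n)"
proof -
  have "g \<in> generate G (simples G P D)"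
    using assms garside by (simp add: garside_def)
  then show ?thesis
  proof (induction rule: generate.induct)
    case one
    show ?case by (intro exI[of _ 0]) simp
  next
    case (incl h)
    then have "\<one> \<preceq> h" "h \<preceq> D" by (auto simp: simples_def)
    moreover have "D [^] (- int 1) \<preceq> \<one>" using D_pow_le_mono[of "- int 1" 0] by simp
    ultimately show ?case using le_trans[of "D [^] (- int 1)" \<one> h] by (intro exI[of _ 1]) simp
  next
    case (inv h)
    then have h: "\<one> \<preceq> h" "h \<preceq> D" by (auto simp: simples_def)
    have hc: "h \<in> carrier G" using h(2) by (rule le_carrier)
    have "inv h \<preceq> \<one>" using le_mult_left[OF _ h(1), of "inv h"] hc by simp
    moreover have "\<one> \<preceq> inv h \<otimes> D" using le_mult_left[OF _ h(2), of "inv h"] hc by simp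
    then have "\<one> \<otimes> D [^] (- 1 :: int) \<preceq> inv h \<otimes> D \<otimes> D [^] (- 1 :: int)"
      by (rule le_mult_D_pow)
    then have "D [^] (- 1 :: int) \<preceq> inv h"
      using hc by (simp add: m_assoc)
    moreover have "\<one> \<preceq> D [^] (int 1)" using D_pow_le_mono[of 0 1] by simp
    ultimately show ?case using le_trans[of "inv h" \<one> D] by (intro exI[of _ 1]) simp
  next
    case (eng h1 h2)
    then obtain n1 n2 where n: "D [^] (- int n1) \<preceq> h1" "h1 \<preceq> D [^] (int n1)"
        "D [^] (- int n2) \<preceq> h2" "h2 \<preceq> D [^] (int n2)" by blast
    have c: "h1 \<in> carrier G" "h2 \<in> carrier G" using n(1,3) by (auto intro: le_carrier)
    have "D [^] (- int n1) \<otimes> D [^] (- int n2) \<preceq> h1 \<otimes> D [^] (- int n2)"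
      using n(1) by (rule le_mult_D_pow)
    also have "\<dots> \<preceq> h1 \<otimes> h2" using c(1) n(3) by (rule le_mult_left)
    finally have 1: "D [^] (- int (n1 + n2)) \<preceq> h1 \<otimes> h2" by simp
    have "h1 \<otimes> h2 \<preceq> h1 \<otimes> D [^] (int n2)" using c(1) n(4) by (rule le_mult_left)
    also have "\<dots> \<preceq> D [^] (int n1) \<otimes> D [^] (int n2)" using n(2) by (rule le_mult_D_pow)
    finally have 2: "h1 \<otimes> h2 \<preceq> D [^] (int (n1 + n2))" by simp
    show ?case using 1 2 by (intro exI[of _ "n1 + n2"] conjI)
  qed
qed

text \<open>Being below both \<open>t \<otimes> D [^] k\<close> and
  \<open>D \<otimes> D [^] k\<close>, the element \<open>t\<close> is below their meet, from which
  \<open>D [^] k\<close> factors out on the right.\<close>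

lemma quotient_by_simple_part_le:
  assumes "t \<in> P" "t \<preceq> D [^] (int (Suc k))"
  shows "inv (glb t D) \<otimes> t \<preceq> D [^] (int k)"
proof -
  have "t \<preceq> glb (t \<otimes> D [^] (int k)) (D \<otimes> D [^] (int k))"
    using assms D_pow_le_mono[of 0 "int k"] le_mult_left[of t "D [^] (0::int)"]
    by (intro le_glb) (auto simp: add.commute)
  then have "t \<preceq> glb t D \<otimes> D [^] (int k)"
    using assms by (simp add: glb_mult_D_pow del: D_mult_pow)
  then have "inv (glb t D) \<otimes> t \<preceq> inv (glb t D) \<otimes> (glb t D \<otimes> D [^] (int k))"
    using assms by (intro le_mult_left) auto
  then show ?thesis using assms by simp
qed

text \<open>Peeling off the greatest simple prefix reduces the exponent by one, and there are only
  finitely many simple elements.\<close>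

lemma finite_D_pow_interval: "finite {t \<in> P. t \<preceq> D [^] (int k)}"
proof (induction k)
  case 0
  have "{t \<in> P. t \<preceq> D [^] (int 0)} \<subseteq> {\<one>}" using le_one_imp by auto
  then show ?case using finite_subset by blast
next
  case (Suc k)
  have fs: "finite (simples G P D)" using garside by (simp add: garside_def)
  have "{t \<in> P. t \<preceq> D [^] (int (Suc k))} \<subseteq>
      (\<lambda>(s, t). s \<otimes> t) ` (simples G P D \<times> {t \<in> P. t \<preceq> D [^] (int k)})"
  proof
    fix t assume "t \<in> {t \<in> P. t \<preceq> D [^] (int (Suc k))}"
    then have t: "t \<in> P" "t \<preceq> D [^] (int (Suc k))" by auto
    have "glb t D \<in> simples G P D"
      using t by (auto simp: simples_def one_le_iff glb_le2)
    moreover have "inv (glb t D) \<otimes> t \<in> P"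
      using glb_le1[of t D] t by (simp add: prec_def)
    moreover have "t = glb t D \<otimes> (inv (glb t D) \<otimes> t)" using t by simp
    ultimately show "t \<in> (\<lambda>(s, t). s \<otimes> t) ` (simples G P D \<times> {t \<in> P. t \<preceq> D [^] (int k)})"
      using quotient_by_simple_part_le[OF t] by force
  qed
  then show ?case using Suc fs finite_subset by blast
qed

text \<open>If the simple part were trivial, \<open>quotient_by_simple_part_le\<close> would lower
  the bound on the unchanged \<open>t\<close> down to \<open>D [^] 0\<close>.\<close>

lemma glb_D_nontrivial:
  assumes "t \<in> P" "t \<noteq> \<one>"
  shows "glb t D \<noteq> \<one>"
proof
  assume eq: "glb t D = \<one>"
  have "t \<preceq> D [^] (int k) \<Longrightarrow> t = \<one>" for k
  proof (induction k)
    case 0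
    then show ?case using assms le_one_imp by auto
  next
    case (Suc k)
    then show ?case using quotient_by_simple_part_le[of t k] eq assms by simp
  qed
  then show False using D_pow_bounds[of t] assms by auto
qed

text \<open>Atomicity bounds the number of nontrivial factors of \<open>x\<close>, and splitting off
  a nontrivial factor on either side lowers the bound for the cofactor. Descent to prefixes yields
  minimal simple elements, descent to remainders yields paths.\<close>

lemma positive_factor_induct [consumes 1, case_names factor]:
  assumes "x \<in> P"
    and step: "\<And>x. x \<in> P \<Longrightarrow>
      (\<And>a b. \<lbrakk>a \<in> P; b \<in> P; b \<noteq> \<one>; x = a \<otimes> b\<rbrakk> \<Longrightarrow> Q a) \<Longrightarrow>
      (\<And>a b. \<lbrakk>a \<in> P; b \<in> P; a \<noteq> \<one>; x = a \<otimes> b\<rbrakk> \<Longrightarrow> Q b) \<Longrightarrow> Q x"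
  shows "Q x"
proof -
  define bnd where "bnd x N \<longleftrightarrow> (\<forall>xs. (\<forall>a\<in>set xs. a \<in> P \<and> a \<noteq> \<one>) \<and> foldr (\<otimes>) xs \<one> = x
       \<longrightarrow> length xs \<le> N)" for x and N :: nat
  have app: "foldr (\<otimes>) (xs @ [b]) \<one> = foldr (\<otimes>) xs \<one> \<otimes> b \<and> foldr (\<otimes>) xs \<one> \<in> carrier G"
    if "\<forall>a\<in>set xs. a \<in> P \<and> a \<noteq> \<one>" "b \<in> P" for xs b
    using that by (induction xs) (auto simp: m_assoc)
  have "x \<in> P \<Longrightarrow> bnd x N \<Longrightarrow> Q x" for N
  proof (induction N arbitrary: x rule: less_induct)
    case (less N)
    show ?case
    proof (rule step[OF less.prems(1)])
      fix a b assume ab: "a \<in> P" "b \<in> P" "b \<noteq> \<one>" "x = a \<otimes> b"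
      have suc: "Suc (length xs) \<le> N" if "\<forall>a\<in>set xs. a \<in> P \<and> a \<noteq> \<one>" "foldr (\<otimes>) xs \<one> = a" for xs
        using less.prems(2)[unfolded bnd_def, rule_format, of "xs @ [b]"] app[OF that(1) ab(2)] that ab
        by auto
      \<comment> \<open>A factorisation of \<open>a\<close> of length 0 or 1 already forces this,
        and it makes \<open>N - 1\<close> smaller than \<open>N\<close>.\<close>
      have "N > 0"
        using suc[of "if a = \<one> then [] else [a]"] ab(1,2) by (cases "a = \<one>") simp_all
      moreover have "bnd a (N - 1)"
        unfolding bnd_def
      proof (intro allI impI, elim conjE)
        fix xs assume "\<forall>a\<in>set xs. a \<in> P \<and> a \<noteq> \<one>" "foldr (\<otimes>) xs \<one> = a"
        from suc[OF this] show "length xs \<le> N - 1" by simp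
      qed
      ultimately show "Q a" using less.IH[of "N - 1" a] ab by simp
    next
      fix a b assume ab: "a \<in> P" "b \<in> P" "a \<noteq> \<one>" "x = a \<otimes> b"
      have suc: "Suc (length xs) \<le> N" if "\<forall>a\<in>set xs. a \<in> P \<and> a \<noteq> \<one>" "foldr (\<otimes>) xs \<one> = b" for xs
        using less.prems(2)[unfolded bnd_def, rule_format, of "a # xs"] that ab by auto
      have "N > 0"
        using suc[of "if b = \<one> then [] else [b]"] ab(1,2) by (cases "b = \<one>") simp_all
      moreover have "bnd b (N - 1)"
        unfolding bnd_def
      proof (intro allI impI, elim conjE)
        fix xs assume "\<forall>a\<in>set xs. a \<in> P \<and> a \<noteq> \<one>" "foldr (\<otimes>) xs \<one> = b"
        from suc[OF this] show "length xs \<le> N - 1" by simp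
      qed
      ultimately show "Q b" using less.IH[of "N - 1" b] ab by simp
    qed
  qed
  moreover obtain N where "bnd x N"
    using atomic_P assms(1) unfolding atomic_def bnd_def by blast
  ultimately show ?thesis using assms(1) by blast
qed

lemma conj_P_shift:
  assumes "x \<in> carrier G"
  shows "D [^] (- i :: int) \<otimes> x \<in> P \<longleftrightarrow> x \<otimes> D [^] (- i) \<in> P"
  using conj_D_pow_in_P_iff[of "x \<otimes> D [^] (- i)" i] assms by (simp add: m_assoc)

end

subsection \<open>Transport along cycling\<close>

locale garside_summit = garside_group +
  fixes X :: 'a and p q :: int
  assumes X_carrier [simp]: "X \<in> carrier G" and p_less_q: "p < q"
begin

text \<open>For the summit values \<open>p\<close> and \<open>q\<close> this is the super summit set
  of \<open>X\<close>; the two bounds turn membership into inequalities free of \<open>ginf\<close>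
  and \<open>gsup\<close>.\<close>

definition S where "S = {V \<in> conjugates G X. D [^] p \<preceq> V \<and> V \<preceq> D [^] q}"

text \<open>On \<open>S\<close>, where \<open>p\<close> is the infimum, this is the initial factor; unlike \<open>iota\<close> it
  has a closed form on the whole group, so the transport below is defined without side conditions.\<close>

definition I where "I V = glb (V \<otimes> D [^] (- p)) D"

definition C where "C V = cj V (I V)"

definition U where "U = {V \<in> S. \<exists>m>0. (C ^^ m) V = V}"

text \<open>The transport of the conjugator \<open>a\<close> along cycling: it leads from
  \<open>C V\<close> to \<open>C (cj V a)\<close>.\<close>

definition tr where "tr V a = inv (I V) \<otimes> (a \<otimes> I (cj V a))"

text \<open>Iteration needs pairs, since the transport depends on a base point that itself moves
  under \<open>C\<close>.\<close>

definition F where "F = (\<lambda>(V, a). (C V, tr V a))"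

lemma S_carrier: "V \<in> S \<Longrightarrow> V \<in> carrier G"
  by (auto simp: S_def intro: le_carrier)

lemma U_imp_S: "V \<in> U \<Longrightarrow> V \<in> S"
  by (simp add: U_def)

lemma U_carrier: "V \<in> U \<Longrightarrow> V \<in> carrier G"
  by (simp add: U_imp_S S_carrier)

text \<open>Both bounds take the shape \<open>x \<preceq> g \<otimes> (x \<otimes> D [^] i)\<close>,
  whose right-hand side is an order automorphism in \<open>x\<close>. This is why meets and joins of
  conjugators stay within \<open>S\<close>.\<close>

lemma conjg_in_S_iff:
  assumes V: "V \<in> S" and x: "x \<in> carrier G"
  shows "cj V x \<in> S \<longleftrightarrow> x \<preceq> V \<otimes> (x \<otimes> D [^] (- p)) \<and> x \<preceq> inv V \<otimes> (x \<otimes> D [^] q)"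
proof -
  have Vc: "V \<in> carrier G" using V by (rule S_carrier)
  obtain a where a: "a \<in> carrier G" "V = cj X a"
    using V by (auto simp: S_def conjugates_def)
  then have "cj V x = cj X (a \<otimes> x)" using x conjg_mult[of X a x] by simp
  then have "cj V x \<in> conjugates G X" using a x by (auto simp: conjugates_def)
  moreover have "D [^] p \<preceq> cj V x \<longleftrightarrow> x \<preceq> V \<otimes> (x \<otimes> D [^] (- p))"
    using conj_P_shift[of "cj V x" p] Vc x by (simp add: prec_def conjg_def m_assoc)
  moreover have "cj V x \<preceq> D [^] q \<longleftrightarrow> x \<preceq> inv V \<otimes> (x \<otimes> D [^] q)"
    using Vc x by (simp add: prec_def conjg_def m_assoc inv_mult_group)
  ultimately show ?thesis by (simp add: S_def)
qed

lemma S_glb: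
  assumes V: "V \<in> S" and ab: "a \<in> carrier G" "b \<in> carrier G" "cj V a \<in> S" "cj V b \<in> S"
  shows "cj V (glb a b) \<in> S"
proof -
  have Vc: "V \<in> carrier G" using V by (rule S_carrier)
  have *: "glb a b \<preceq> g \<otimes> (glb a b \<otimes> D [^] i)"
    if "g \<in> carrier G" "a \<preceq> g \<otimes> (a \<otimes> D [^] i)" "b \<preceq> g \<otimes> (b \<otimes> D [^] i)" for g and i :: int
  proof -
    have "glb a b \<preceq> glb (g \<otimes> (a \<otimes> D [^] i)) (g \<otimes> (b \<otimes> D [^] i))"
      by (intro le_glb le_trans[OF glb_le1 that(2)] le_trans[OF glb_le2 that(3)] ab)
    then show ?thesis using that(1) ab by (simp add: glb_mult_left glb_mult_D_pow)
  qed
  show ?thesis using ab Vc by (simp add: conjg_in_S_iff[OF V] *)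
qed

lemma S_lub:
  assumes V: "V \<in> S" and ab: "a \<in> carrier G" "b \<in> carrier G" "cj V a \<in> S" "cj V b \<in> S"
  shows "cj V (lub a b) \<in> S"
proof -
  have Vc: "V \<in> carrier G" using V by (rule S_carrier)
  have lc: "lub a b \<in> carrier G" using le_lub1[OF ab(1,2)] by (rule le_carrier)
  have *: "lub a b \<preceq> g \<otimes> (lub a b \<otimes> D [^] i)"
    if g: "g \<in> carrier G" and h: "a \<preceq> g \<otimes> (a \<otimes> D [^] i)" "b \<preceq> g \<otimes> (b \<otimes> D [^] i)" for g and i :: int
  proof (rule lub_le)
    show "a \<preceq> g \<otimes> (lub a b \<otimes> D [^] i)"
      by (rule le_trans[OF h(1)]) (intro le_mult_left g le_mult_D_pow le_lub1 ab)
    show "b \<preceq> g \<otimes> (lub a b \<otimes> D [^] i)"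
      by (rule le_trans[OF h(2)]) (intro le_mult_left g le_mult_D_pow le_lub2 ab)
  qed
  show ?thesis using ab Vc lc by (simp add: conjg_in_S_iff[OF V] *)
qed

lemma finite_S: "finite S"
proof (rule finite_subset)
  show "S \<subseteq> (\<lambda>t. D [^] p \<otimes> t) ` {t \<in> P. t \<preceq> D [^] (int (nat (q - p)))}"
  proof
    fix V assume V: "V \<in> S"
    then have Vc: "V \<in> carrier G" by (rule S_carrier)
    have "D [^] p \<preceq> V" "V \<preceq> D [^] q" using V by (auto simp: S_def)
    then have "D [^] (- p) \<otimes> D [^] p \<preceq> D [^] (- p) \<otimes> V" "D [^] (- p) \<otimes> V \<preceq> D [^] (- p) \<otimes> D [^] q"
      by (intro le_mult_left; simp)+
    then have "D [^] (- p) \<otimes> V \<in> P" "D [^] (- p) \<otimes> V \<preceq> D [^] (int (nat (q - p)))"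
      using p_less_q by (simp_all add: one_le_iff)
    moreover have "V = D [^] p \<otimes> (D [^] (- p) \<otimes> V)" using Vc by simp
    ultimately show "V \<in> (\<lambda>t. D [^] p \<otimes> t) ` {t \<in> P. t \<preceq> D [^] (int (nat (q - p)))}"
      by blast
  qed
qed (intro finite_imageI finite_D_pow_interval)

lemma I_carrier [simp]: "V \<in> carrier G \<Longrightarrow> I V \<in> carrier G"
  by (simp add: I_def)

lemma C_carrier [simp]: "V \<in> carrier G \<Longrightarrow> C V \<in> carrier G"
  by (simp add: C_def)

lemma tr_carrier [simp]: "V \<in> carrier G \<Longrightarrow> a \<in> carrier G \<Longrightarrow> tr V a \<in> carrier G"
  by (simp add: tr_def)

lemma I_le_D: "V \<in> carrier G \<Longrightarrow> I V \<preceq> D"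
  by (simp add: I_def glb_le2)

lemma I_le: "V \<in> carrier G \<Longrightarrow> I V \<preceq> V \<otimes> D [^] (- p)"
  by (simp add: I_def glb_le1)

lemma initial_in_P: "V \<in> S \<Longrightarrow> V \<otimes> D [^] (- p) \<in> P"
proof -
  assume V: "V \<in> S"
  then have "D [^] (- p) \<otimes> V \<in> P" by (simp add: S_def prec_def)
  then show ?thesis using conj_P_shift[OF S_carrier[OF V]] by blast
qed

lemma I_in_P: "V \<in> S \<Longrightarrow> I V \<in> P"
  by (simp add: I_def initial_in_P)

text \<open>Removing the initial factor lowers the supremum bound by one: \<open>V\<close> is below
  \<open>D \<otimes> D [^] (q - 1)\<close> and, since \<open>p < q\<close>, below
  \<open>V \<otimes> D [^] (- p) \<otimes> D [^] (q - 1)\<close>.\<close>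

lemma le_I_mult:
  assumes V: "V \<in> S"
  shows "V \<preceq> I V \<otimes> D [^] (q - 1)"
proof -
  have Vc: "V \<in> carrier G" using V by (rule S_carrier)
  have "\<one> \<preceq> D [^] (q - p - 1)" using D_pow_le_mono[of 0 "q - p - 1"] p_less_q by simp
  then have "V \<preceq> V \<otimes> D [^] (q - p - 1)" using Vc by (simp add: le_mult_right one_le_iff)
  moreover have "V \<preceq> D [^] q" using V by (simp add: S_def)
  ultimately have "V \<preceq> glb (V \<otimes> D [^] (q - p - 1)) (D [^] q)" by (rule le_glb)
  also have "glb (V \<otimes> D [^] (q - p - 1)) (D [^] q) =
      glb (V \<otimes> D [^] (- p) \<otimes> D [^] (q - 1)) (D \<otimes> D [^] (q - 1))"
    using Vc by (simp add: m_assoc algebra_simps)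
  also have "\<dots> = I V \<otimes> D [^] (q - 1)"
    unfolding I_def using Vc by (intro glb_mult_D_pow) simp_all
  finally show ?thesis .
qed

text \<open>In the criterion \<open>conjg_in_S_iff\<close>, the first inequality comes from
  \<open>I_le\<close> by appending a positive factor, the second from
  \<open>V \<otimes> I V \<preceq> V \<otimes> D\<close> and \<open>le_I_mult\<close>.\<close>

lemma C_in_S:
  assumes V: "V \<in> S"
  shows "C V \<in> S"
proof -
  have Vc [simp]: "V \<in> carrier G" using V by (rule S_carrier)
  have "D [^] p \<otimes> (I V \<otimes> D [^] (- p)) \<in> P"
    using conj_D_pow_in_P_iff[of "I V" "- p"] I_in_P[OF V] by simp
  then have "V \<otimes> D [^] (- p) \<preceq> V \<otimes> D [^] (- p) \<otimes> (D [^] p \<otimes> (I V \<otimes> D [^] (- p)))"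
    by (intro le_mult_right) simp_all
  with I_le[OF Vc] have 1: "I V \<preceq> V \<otimes> D [^] (- p) \<otimes> (D [^] p \<otimes> (I V \<otimes> D [^] (- p)))"
    by (rule le_trans)
  have "V \<otimes> I V \<preceq> V \<otimes> D"
    by (simp add: I_le_D le_mult_left)
  also have "\<dots> \<preceq> I V \<otimes> D [^] (q - 1) \<otimes> D [^] (1::int)"
    using le_mult_D_pow[OF le_I_mult[OF V], of 1] by simp
  finally have "V \<otimes> I V \<preceq> I V \<otimes> D [^] q" by (simp add: m_assoc)
  then have "inv V \<otimes> (V \<otimes> I V) \<preceq> inv V \<otimes> (I V \<otimes> D [^] q)"
    by (rule le_mult_left[rotated]) simp
  then show ?thesis
    using 1 by (simp add: C_def conjg_in_S_iff[OF V] m_assoc)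
qed

lemma conjg_D_pow_in_S:
  assumes V: "V \<in> S"
  shows "cj V (D [^] (i::int)) \<in> S"
proof -
  have Vc [simp]: "V \<in> carrier G" using V by (rule S_carrier)
  have "\<one> \<preceq> inv V \<otimes> D [^] q" using V by (simp add: S_def prec_def)
  from le_mult_D_pow[OF this, of i] have 1: "D [^] i \<preceq> inv V \<otimes> (D [^] i \<otimes> D [^] q)"
    by (simp add: m_assoc add.commute)
  have "\<one> \<preceq> V \<otimes> D [^] (- p)" using initial_in_P[OF V] by (simp add: one_le_iff)
  from le_mult_D_pow[OF this, of i] have 2: "D [^] i \<preceq> V \<otimes> (D [^] i \<otimes> D [^] (- p))"
    by (simp add: m_assoc add.commute)
  show ?thesis using 1 2 by (simp add: conjg_in_S_iff[OF V])
qed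

lemma mult_I_conjg:
  assumes [simp]: "V \<in> carrier G" "a \<in> carrier G"
  shows "a \<otimes> I (cj V a) = glb (V \<otimes> (a \<otimes> D [^] (- p))) (a \<otimes> D)"
proof -
  have "a \<otimes> (cj V a \<otimes> D [^] (- p)) = V \<otimes> (a \<otimes> D [^] (- p))"
    by (simp add: conjg_def m_assoc)
  then show ?thesis unfolding I_def by (subst glb_mult_left[symmetric]) simp_all
qed

lemma glb_glb_swap:
  assumes [simp]: "a \<in> carrier G" "b \<in> carrier G" "c \<in> carrier G" "d \<in> carrier G"
  shows "glb (glb a b) (glb c d) = glb (glb a c) (glb b d)"
proof (rule glb_eqI)
  have le: "glb (glb x y) (glb z w) \<preceq> x" "glb (glb x y) (glb z w) \<preceq> y"
    "glb (glb x y) (glb z w) \<preceq> z" "glb (glb x y) (glb z w) \<preceq> w"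
    if [simp]: "x \<in> carrier G" "y \<in> carrier G" "z \<in> carrier G" "w \<in> carrier G" for x y z w
    by (rule le_trans[OF glb_le1 glb_le1] le_trans[OF glb_le1 glb_le2]
        le_trans[OF glb_le2 glb_le1] le_trans[OF glb_le2 glb_le2]; simp)+
  show "glb (glb a c) (glb b d) \<preceq> glb a b" "glb (glb a c) (glb b d) \<preceq> glb c d"
    by (intro le_glb le; simp)+
  fix x assume x: "x \<preceq> glb a b" "x \<preceq> glb c d"
  show "x \<preceq> glb (glb a c) (glb b d)"
    by (intro le_glb le_trans[OF x(1) glb_le1] le_trans[OF x(1) glb_le2]
        le_trans[OF x(2) glb_le1] le_trans[OF x(2) glb_le2]) simp_all
qed

text \<open>By \<open>mult_I_conjg\<close> the transport is, up to a fixed left factor, the meet of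
  two translates of its argument; each translate commutes with meets, and the four terms are
  regrouped.\<close>

lemma tr_glb:
  assumes [simp]: "V \<in> carrier G" "a \<in> carrier G" "b \<in> carrier G"
  shows "tr V (glb a b) = glb (tr V a) (tr V b)"
proof -
  have "glb (V \<otimes> (glb a b \<otimes> D [^] (- p))) (glb a b \<otimes> D) =
      glb (glb (V \<otimes> (a \<otimes> D [^] (- p))) (V \<otimes> (b \<otimes> D [^] (- p)))) (glb (a \<otimes> D) (b \<otimes> D))"
    using glb_mult_D_pow[of a b 1] by (simp add: glb_mult_left glb_mult_D_pow)
  also have "\<dots> = glb (glb (V \<otimes> (a \<otimes> D [^] (- p))) (a \<otimes> D)) (glb (V \<otimes> (b \<otimes> D [^] (- p))) (b \<otimes> D))"
    by (rule glb_glb_swap) simp_all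
  finally show ?thesis
    by (simp add: tr_def mult_I_conjg glb_mult_left)
qed

lemma tr_mono:
  assumes "V \<in> carrier G" "a \<preceq> b"
  shows "tr V a \<preceq> tr V b"
proof -
  have c: "a \<in> carrier G" "b \<in> carrier G" using assms(2) by (auto intro: le_carrier)
  have "tr V a = glb (tr V a) (tr V b)"
    using tr_glb[OF assms(1) c] glb_absorb[OF assms(2)] by simp
  then show ?thesis using glb_le2[of "tr V a" "tr V b"] assms(1) c by simp
qed

lemma I_conjg_D_pow:
  assumes [simp]: "V \<in> carrier G"
  shows "D [^] (i::int) \<otimes> I (cj V (D [^] i)) = I V \<otimes> D [^] i"
proof -
  have "D [^] i \<otimes> I (cj V (D [^] i)) = glb (V \<otimes> D [^] (- p) \<otimes> D [^] i) (D \<otimes> D [^] i)"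
    by (simp add: mult_I_conjg m_assoc add.commute)
  also have "\<dots> = I V \<otimes> D [^] i" unfolding I_def by (rule glb_mult_D_pow) simp_all
  finally show ?thesis .
qed

lemma tr_D_pow [simp]: "V \<in> carrier G \<Longrightarrow> tr V (D [^] (i::int)) = D [^] i"
  by (simp add: tr_def I_conjg_D_pow)

lemma tr_one [simp]: "V \<in> carrier G \<Longrightarrow> tr V \<one> = \<one>"
  using tr_D_pow[of V 0] by simp

lemma conjg_C_tr:
  assumes [simp]: "V \<in> carrier G" "a \<in> carrier G"
  shows "cj (C V) (tr V a) = C (cj V a)"
  by (simp add: C_def tr_def conjg_mult)

lemma C_conjg_D_pow:
  assumes "V \<in> carrier G"
  shows "C (cj V (D [^] (i::int))) = cj (C V) (D [^] i)"
  using conjg_C_tr[of V "D [^] i"] assms by simp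

lemma C_in_U: assumes "V \<in> U" shows "C V \<in> U"
proof -
  obtain m where "m > 0" "(C ^^ m) V = V" using assms by (auto simp: U_def)
  then have "(C ^^ m) (C V) = C V" by (metis funpow_swap1)
  then show ?thesis using \<open>m > 0\<close> assms C_in_S by (auto simp: U_def)
qed

lemma conjg_D_pow_in_U:
  assumes "V \<in> U"
  shows "cj V (D [^] (i::int)) \<in> U"
proof -
  obtain m where m: "m > 0" "(C ^^ m) V = V" using assms by (auto simp: U_def)
  have "(C ^^ n) (cj V (D [^] i)) = cj ((C ^^ n) V) (D [^] i) \<and> (C ^^ n) V \<in> carrier G" for n
    by (induction n) (use assms U_carrier C_conjg_D_pow in auto)
  then show ?thesis using m assms conjg_D_pow_in_S by (auto simp: U_def)
qed

text \<open>If \<open>m\<close> and \<open>n\<close> are periods of two points, then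
  \<open>C ^^ (m * n - 1)\<close> undoes \<open>C\<close> on both.\<close>

lemma inj_on_C_U: "inj_on C U"
proof (rule inj_onI)
  fix V W assume h: "V \<in> U" "W \<in> U" "C V = C W"
  obtain m n where m: "m > 0" "(C ^^ m) V = V" and n: "n > 0" "(C ^^ n) W = W"
    using h(1,2) by (auto simp: U_def)
  have 1: "(C ^^ (m * n)) V = V" "(C ^^ (m * n)) W = W"
    using funpow_mult_fixed[OF m(2), of n] funpow_mult_fixed[OF n(2), of m] by (simp_all add: mult.commute)
  have "m * n \<noteq> 0" using m n by simp
  then obtain k where "m * n = Suc k" using not0_implies_Suc by blast
  then have "(C ^^ k) (C V) = V" "(C ^^ k) (C W) = W" using 1 by (metis comp_apply funpow_Suc_right)+
  then show "V = W" using h(3) by metis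
qed

section \<open>Iterated transport and its periodicity on \<open>U\<close>\<close>

lemma fst_F_pow: "fst ((F ^^ n) (V, a)) = (C ^^ n) V"
  by (induction n) (auto simp: F_def split_beta)

lemma C_pow_carrier: "V \<in> carrier G \<Longrightarrow> (C ^^ n) V \<in> carrier G"
  by (induction n) auto

lemma snd_F_pow_Suc: "snd ((F ^^ Suc n) (V, a)) = tr ((C ^^ n) V) (snd ((F ^^ n) (V, a)))"
  using fst_F_pow[of n V a] by (simp add: F_def split_beta)

lemma snd_F_pow_carrier:
  "V \<in> carrier G \<Longrightarrow> a \<in> carrier G \<Longrightarrow> snd ((F ^^ n) (V, a)) \<in> carrier G"
proof (induction n)
  case (Suc n)
  then show ?case by (simp only: snd_F_pow_Suc C_pow_carrier tr_carrier)
qed simp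

lemma conjg_F_pow:
  assumes "V \<in> carrier G" "a \<in> carrier G"
  shows "cj ((C ^^ n) V) (snd ((F ^^ n) (V, a))) = (C ^^ n) (cj V a)"
proof (induction n)
  case (Suc n)
  then show ?case
    using assms conjg_C_tr[of "(C ^^ n) V" "snd ((F ^^ n) (V, a))"]
    by (simp only: snd_F_pow_Suc C_pow_carrier snd_F_pow_carrier) (simp add: C_pow_carrier snd_F_pow_carrier)
qed simp

lemma snd_F_pow_glb:
  assumes "V \<in> carrier G" "a \<in> carrier G" "b \<in> carrier G"
  shows "snd ((F ^^ n) (V, glb a b)) = glb (snd ((F ^^ n) (V, a))) (snd ((F ^^ n) (V, b)))"
proof (induction n)
  case (Suc n)
  then show ?case
    using assms by (simp only: snd_F_pow_Suc tr_glb C_pow_carrier snd_F_pow_carrier)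
qed simp

lemma snd_F_pow_mono:
  assumes "V \<in> carrier G" "a \<preceq> b"
  shows "snd ((F ^^ n) (V, a)) \<preceq> snd ((F ^^ n) (V, b))"
proof (induction n)
  case (Suc n)
  then show ?case
    using assms by (simp only: snd_F_pow_Suc tr_mono C_pow_carrier)
qed (simp add: assms)

text \<open>The bound \<open>D [^] k\<close> makes this set finite and survives the transport, which
  fixes powers of \<open>D\<close>.\<close>

definition M where "M k = {(V, a). V \<in> U \<and> cj V a \<in> U \<and> a \<in> P \<and> a \<preceq> D [^] (int k)}"

lemma F_in_M: "x \<in> M k \<Longrightarrow> F x \<in> M k"
  using tr_mono[of "fst x" \<one> "snd x"] tr_mono[of "fst x" "snd x" "D [^] (int k)"]
  by (auto simp: M_def F_def conjg_C_tr U_carrier C_in_U one_le_iff)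

lemma F_pow_in_M: "x \<in> M k \<Longrightarrow> (F ^^ n) x \<in> M k"
  by (induction n) (simp_all add: F_in_M)

text \<open>A positive conjugator between elements of \<open>U\<close> is recovered from its transport because
  \<open>C\<close> is injective on \<open>U\<close>; so \<open>F\<close> permutes the finite set \<open>M k\<close>.\<close>

lemma F_pow_eq_id:
  obtains N :: nat where "N > 0" "\<And>x n. x \<in> M k \<Longrightarrow> (F ^^ (N * n)) x = x"
proof (rule finite_inj_self_map_periodic[of "M k" F])
  have "M k \<subseteq> S \<times> {t \<in> P. t \<preceq> D [^] (int k)}" by (auto simp: M_def U_imp_S)
  then show "finite (M k)"
    using finite_S finite_D_pow_interval finite_subset by blast
  show "F ` M k \<subseteq> M k" using F_in_M by blast
  show "inj_on F (M k)"
  proof (rule inj_onI, clarify)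
    fix V a W b assume h: "(V, a) \<in> M k" "(W, b) \<in> M k" "F (V, a) = F (W, b)"
    have c: "V \<in> carrier G" "W \<in> carrier G" "a \<in> carrier G" "b \<in> carrier G"
      using h(1,2) by (auto simp: M_def U_carrier)
    have "C V = C W" "tr V a = tr W b" using h(3) by (auto simp: F_def)
    then have VW: "V = W" using h(1,2) inj_on_C_U by (auto simp: M_def inj_on_def)
    have "C (cj V a) = C (cj W b)"
      using conjg_C_tr[OF c(1,3)] conjg_C_tr[OF c(2,4)] \<open>C V = C W\<close> \<open>tr V a = tr W b\<close> by simp
    then have "cj V a = cj W b" using h(1,2) inj_on_C_U by (auto simp: M_def inj_on_def)
    then have "a = b" using \<open>tr V a = tr W b\<close> VW c by (simp add: tr_def)
    then show "V = W \<and> a = b" using VW by simp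
  qed
qed (use that in blast)

text \<open>A common bound on \<open>a\<close> and \<open>b\<close> places both in one finite
  \<open>M\<close>, so a single number of transport steps returns both, hence also their meet. The
  conjugate by the meet is then periodic under \<open>C\<close>.\<close>

lemma U_glb:
  assumes V: "V \<in> U" and a: "a \<in> P" "cj V a \<in> U" and b: "b \<in> P" "cj V b \<in> U"
  shows "cj V (glb a b) \<in> U"
proof -
  obtain k l where "a \<preceq> D [^] (int k)" "b \<preceq> D [^] (int l)"
    using D_pow_bounds[of a] D_pow_bounds[of b] a b by auto
  then have "a \<preceq> D [^] (int (max k l))" "b \<preceq> D [^] (int (max k l))"
    by (auto intro: le_trans[OF _ D_pow_le_mono])
  then have M: "(V, a) \<in> M (max k l)" "(V, b) \<in> M (max k l)"
    using V a b by (auto simp: M_def)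
  obtain N where N: "N > 0" "\<And>x n. x \<in> M (max k l) \<Longrightarrow> (F ^^ (N * n)) x = x"
    using F_pow_eq_id by blast
  have FN: "(F ^^ N) (V, a) = (V, a)" "(F ^^ N) (V, b) = (V, b)"
    using N(2)[OF M(1), of 1] N(2)[OF M(2), of 1] by simp_all
  have Vc: "V \<in> carrier G" using V by (rule U_carrier)
  have "snd ((F ^^ N) (V, glb a b)) = glb a b"
    using FN a b Vc by (simp add: snd_F_pow_glb)
  moreover have "(C ^^ N) V = V" using FN(1) fst_F_pow[of N V a] by simp
  ultimately have "(C ^^ N) (cj V (glb a b)) = cj V (glb a b)"
    using conjg_F_pow[of V "glb a b" N] Vc a b by simp
  moreover have "cj V (glb a b) \<in> S" using V a b by (intro S_glb) (auto simp: U_imp_S)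
  ultimately show ?thesis using N(1) by (auto simp: U_def)
qed

subsection \<open>Minimal simple elements\<close>

definition umin where
  "umin V s \<longleftrightarrow> s \<in> P \<and> s \<preceq> D \<and> s \<noteq> \<one> \<and> cj V s \<in> U \<and>
     (\<forall>t\<in>P. t \<preceq> s \<longrightarrow> cj V t \<in> U \<longrightarrow> t = \<one> \<or> t = s)"

text \<open>Replacing \<open>b\<close> by its meet with \<open>D\<close> keeps it nontrivial and, by
  \<open>U_glb\<close>, still leading to \<open>U\<close>. Below a simple element the descent to
  proper prefixes terminates.\<close>

lemma umin_exists:
  assumes V: "V \<in> U" and b: "b \<in> P" "b \<noteq> \<one>" "cj V b \<in> U"
  shows "\<exists>s. umin V s \<and> s \<preceq> b"
proof -
  have *: "x \<in> P \<Longrightarrow> x \<noteq> \<one> \<Longrightarrow> x \<preceq> D \<Longrightarrow> cj V x \<in> U \<Longrightarrow> \<exists>s. umin V s \<and> s \<preceq> x" for x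
  proof (induction x rule: positive_factor_induct)
    case (factor x)
    show ?case
    proof (cases "umin V x")
      case True
      then show ?thesis using factor.hyps by (intro exI[of _ x]) simp
    next
      case False
      then obtain t where t: "t \<in> P" "t \<preceq> x" "cj V t \<in> U" "t \<noteq> \<one>" "t \<noteq> x"
        using factor.prems factor.hyps by (auto simp: umin_def)
      have "inv t \<otimes> x \<in> P" using t(2) by (simp add: prec_def)
      moreover have eq: "x = t \<otimes> (inv t \<otimes> x)" using t(1) factor.hyps by simp
      moreover have "inv t \<otimes> x \<noteq> \<one>" using eq t(1,5) by (metis P_carrier r_one)
      ultimately obtain s where "umin V s" "s \<preceq> t"
        using factor.IH(1)[OF t(1)] t le_trans[OF t(2) factor.prems(2)] by blast
      then show ?thesis using le_trans[OF _ t(2)] by blast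
    qed
  qed
  have "cj V D \<in> U" using conjg_D_pow_in_U[OF V, of 1] by simp
  then have "cj V (glb b D) \<in> U" using V b by (intro U_glb) auto
  then obtain s where s: "umin V s" "s \<preceq> glb b D"
    using *[of "glb b D"] glb_D_nontrivial[OF b(1,2)] b(1) glb_le2[of b D] by auto
  have "glb b D \<preceq> b" using b(1) by (simp add: glb_le1)
  then show ?thesis using s le_trans by blast
qed

text \<open>Minimality survives transport: carrying \<open>w\<close> through the rest of a period
  produces a prefix of \<open>s\<close>, to which the minimality of \<open>s\<close>
  applies.\<close>

lemma umin_tr:
  assumes V: "V \<in> U" and s: "umin V s"
    and w: "w \<in> P" "w \<preceq> tr V s" "cj (C V) w \<in> U"
  shows "w = \<one> \<or> w = tr V s"
proof -
  have Vc: "V \<in> carrier G" using V by (rule U_carrier)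
  have s': "s \<in> P" "s \<preceq> D" "cj V s \<in> U" using s by (auto simp: umin_def)
  obtain N where N: "N > 0" "\<And>x n. x \<in> M 1 \<Longrightarrow> (F ^^ (N * n)) x = x"
    using F_pow_eq_id by blast
  then obtain m where m: "N = Suc m" using not0_implies_Suc by blast
  have id: "(F ^^ Suc m) x = x" if "x \<in> M 1" for x using N(2)[OF that, of 1] m by simp
  have "tr V s \<preceq> D" using tr_mono[OF Vc s'(2)] tr_D_pow[OF Vc, of 1] by simp
  then have "w \<preceq> D" by (rule le_trans[OF w(2)])
  then have Mw: "(C V, w) \<in> M 1" using w V by (simp add: M_def C_in_U)
  have Ms: "(V, s) \<in> M 1" using s' V by (simp add: M_def)
  \<comment> \<open>These \<open>m = N - 1\<close> further steps bring the base point from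
    \<open>C V\<close> back to \<open>V\<close>; one more transport turns \<open>v\<close> into
    \<open>w\<close> again.\<close>
  define v where "v = snd ((F ^^ m) (C V, w))"
  have "(C ^^ Suc m) V = V" using id[OF Ms] fst_F_pow[of "Suc m" V s] by simp
  then have "(C ^^ m) (C V) = V" by (simp only: funpow_Suc_right comp_apply)
  then have Fm: "(F ^^ m) (C V, w) = (V, v)"
    using fst_F_pow[of m "C V" w] by (simp add: v_def prod_eq_iff)
  then have v: "v \<in> P" "cj V v \<in> U" using F_pow_in_M[OF Mw, of m] by (auto simp: M_def)
  have "v \<preceq> snd ((F ^^ m) (C V, tr V s))"
    unfolding v_def using Vc w(2) by (intro snd_F_pow_mono) simp_all
  also have "(F ^^ m) (C V, tr V s) = (F ^^ m) (F (V, s))" by (simp add: F_def)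
  also have "\<dots> = (V, s)" using id[OF Ms] by (simp only: funpow_Suc_right comp_apply)
  finally have "v \<preceq> s" by simp
  then have "v = \<one> \<or> v = s" using v s by (simp add: umin_def)
  moreover have "tr V v = w" using id[OF Mw] Fm by (simp add: F_def)
  ultimately show ?thesis using Vc by auto
qed

text \<open>The orbit stays in the finite set \<open>S\<close>, so it runs into a cycle.\<close>

lemma eventually_in_U:
  assumes V: "V \<in> S"
  shows "\<exists>k. \<forall>n\<ge>k. (C ^^ n) V \<in> U"
proof -
  have inS: "(C ^^ n) V \<in> S" for n using V by (induction n) (simp_all add: C_in_S)
  then have "finite (range (\<lambda>n. (C ^^ n) V))" using finite_S by (auto intro: finite_subset)
  then have "\<not> inj (\<lambda>n. (C ^^ n) V)" using finite_imageD infinite_UNIV_nat by blast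
  then obtain i j where ij: "i < j" "(C ^^ i) V = (C ^^ j) V"
    unfolding inj_def by (metis linorder_neqE_nat)
  have "(C ^^ n) V \<in> U" if n: "n \<ge> i" for n
  proof -
    have "(C ^^ (j - i)) ((C ^^ n) V) = (C ^^ (j - i + n)) V" by (simp add: funpow_add)
    also have "j - i + n = (n - i) + j" using n ij(1) by simp
    also have "(C ^^ \<dots>) V = (C ^^ (n - i)) ((C ^^ i) V)" by (simp add: funpow_add ij(2))
    also have "\<dots> = (C ^^ n) V" using n by (metis comp_apply funpow_add le_add_diff_inverse2)
    finally show ?thesis using ij(1) inS by (auto simp: U_def intro!: exI[of _ "j - i"])
  qed
  then show ?thesis by blast
qed

text \<open>The join \<open>j\<close> of \<open>s\<close> and \<open>I V\<close> need not lead to \<open>U\<close>. But iterating the transport, which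
  fixes \<open>s\<close>, \<open>I V\<close> and \<open>D\<close>, turns it into a simple element \<open>m\<close> that still dominates both and does
  lead to \<open>U\<close>; minimality of the transport of \<open>s\<close> then puts \<open>s \<otimes> I (cj V s)\<close> below \<open>m\<close>.\<close>

lemma umin_black_or_grey:
  assumes V: "V \<in> U" and s: "umin V s" and nle: "\<not> s \<preceq> I V"
  shows "s \<preceq> inv V \<otimes> D [^] q"
proof -
  have Vc [simp]: "V \<in> carrier G" using V by (rule U_carrier)
  have VS: "V \<in> S" using V by (rule U_imp_S)
  have s': "s \<in> P" "s \<preceq> D" "cj V s \<in> U" using s by (auto simp: umin_def)
  have sc [simp]: "s \<in> carrier G" using s' by simp
  have IP: "I V \<in> P" using VS by (rule I_in_P)
  have CU: "cj V (I V) \<in> U" using C_in_U[OF V] by (simp add: C_def)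
  define j where "j = lub s (I V)"
  have sj: "s \<preceq> j" and Ij: "I V \<preceq> j" by (simp_all add: j_def le_lub1 le_lub2)
  have jD: "j \<preceq> D" unfolding j_def using s'(2) by (intro lub_le) (simp_all add: I_le_D)
  have jc: "j \<in> carrier G" using sj by (rule le_carrier)
  have "cj V j \<in> S" unfolding j_def using VS s' CU by (intro S_lub) (simp_all add: U_imp_S)
  then obtain k where k: "\<And>n. n \<ge> k \<Longrightarrow> (C ^^ n) (cj V j) \<in> U" using eventually_in_U by blast
  obtain N where N: "N > 0" "\<And>x n. x \<in> M 1 \<Longrightarrow> (F ^^ (N * n)) x = x"
    using F_pow_eq_id by blast
  \<comment> \<open>As a multiple of the period it fixes \<open>s\<close>, \<open>I V\<close> and
    \<open>D\<close>; being at least \<open>k\<close>, it also carries \<open>cj V j\<close> into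
    \<open>U\<close>.\<close>
  define n where "n = N * k"
  have fix_n: "snd ((F ^^ n) (V, a)) = a" "(C ^^ n) V = V" if "a \<in> P" "a \<preceq> D" "cj V a \<in> U" for a
    using N(2)[of "(V, a)" k] that V fst_F_pow[of n V a] by (simp_all add: M_def n_def)
  define m where "m = snd ((F ^^ n) (V, j))"
  have sm: "s \<preceq> m" using snd_F_pow_mono[OF Vc sj, of n] fix_n(1)[OF s'] by (simp add: m_def)
  have Im: "I V \<preceq> m"
    using snd_F_pow_mono[OF Vc Ij, of n] fix_n(1)[OF IP _ CU] by (simp add: m_def I_le_D)
  have "cj V D \<in> U" using conjg_D_pow_in_U[OF V, of 1] by simp
  then have mD: "m \<preceq> D"
    using snd_F_pow_mono[OF Vc jD, of n] fix_n(1)[of D] by (simp add: m_def)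
  have mP: "m \<in> P" using s'(1) sm by (rule P_prefix)
  have "cj V m = (C ^^ n) (cj V j)"
    using conjg_F_pow[OF Vc jc, of n] fix_n(2)[OF s'] by (simp add: m_def)
  moreover have "n \<ge> k" using N(1) by (simp add: n_def)
  ultimately have mU: "cj V m \<in> U" using k by simp
  define r where "r = s \<otimes> I (cj V s)"
  have r_eq: "r = I V \<otimes> tr V s" by (simp add: r_def tr_def)
  have rP: "r \<in> P" using s' by (simp add: r_def I_in_P U_imp_S)
  have rU: "cj V r \<in> U" using C_in_U[OF s'(3)] by (simp add: r_def C_def conjg_mult)
  have sr: "s \<preceq> r" unfolding r_def using s' by (intro le_mult_right) (simp_all add: I_in_P U_imp_S)
  have "tr V s \<in> P" using tr_mono[of V \<one> s] s'(1) by (simp add: one_le_iff)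
  then have Ir: "I V \<preceq> r" unfolding r_eq by (intro le_mult_right) simp_all
  define g where "g = glb m r"
  have gU: "cj V g \<in> U" unfolding g_def using V mP mU rP rU by (intro U_glb)
  have gc [simp]: "g \<in> carrier G" using mP rP by (simp add: g_def)
  have Ig: "I V \<preceq> g" unfolding g_def using Im Ir by (rule le_glb)
  have sg: "s \<preceq> g" unfolding g_def using sm sr by (rule le_glb)
  define w where "w = inv (I V) \<otimes> g"
  have gw: "g = I V \<otimes> w" by (simp add: w_def)
  have "w \<in> P" using Ig by (simp add: w_def prec_def)
  moreover have "w \<preceq> tr V s"
  proof -
    have "g \<preceq> r" unfolding g_def using mP rP by (intro glb_le2) simp_all
    then have "inv (I V) \<otimes> g \<preceq> inv (I V) \<otimes> r" by (intro le_mult_left) simp_all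
    then show ?thesis by (simp add: w_def r_eq)
  qed
  moreover have "cj (C V) w \<in> U"
    using gU by (simp add: C_def conjg_mult w_def)
  ultimately have "w = \<one> \<or> w = tr V s" by (rule umin_tr[OF V s])
  \<comment> \<open>Otherwise \<open>g = I V\<close>, and \<open>s \<preceq> g\<close> contradicts
    \<open>nle\<close>.\<close>
  moreover have "w \<noteq> \<one>" using sg nle gw by auto
  ultimately have "g = r" by (simp add: gw r_eq)
  moreover have "g \<preceq> m" unfolding g_def using mP rP by (intro glb_le1) simp_all
  ultimately have rD: "r \<preceq> D" using mD by (auto intro: le_trans)
  \<comment> \<open>Since \<open>s \<otimes> cj V s = V \<otimes> s\<close>, simplicity of
    \<open>r\<close> gives \<open>V \<otimes> s \<preceq> D [^] q\<close>, which is the grey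
    condition.\<close>
  have "s \<otimes> cj V s \<preceq> s \<otimes> (I (cj V s) \<otimes> D [^] (q - 1))"
    using s' by (intro le_mult_left le_I_mult) (simp_all add: U_imp_S)
  also have "\<dots> = r \<otimes> D [^] (q - 1)" by (simp add: r_def m_assoc)
  also have "\<dots> \<preceq> D \<otimes> D [^] (q - 1)" using rD by (rule le_mult_D_pow)
  finally have "V \<otimes> s \<preceq> D [^] q" by (simp add: conjg_def m_assoc)
  then have "inv V \<otimes> (V \<otimes> s) \<preceq> inv V \<otimes> D [^] q" by (intro le_mult_left) simp_all
  then show ?thesis by simp
qed

subsection \<open>Grey paths\<close>

text \<open>By \<open>E_Suc\<close> this is a product of \<open>k\<close> copies of
  \<open>inv V \<otimes> D [^] q\<close>, each conjugated by a power of \<open>D\<close>. It bounds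
  the product of \<open>k\<close> successive grey arrows from \<open>V\<close>.\<close>

definition E where "E k V = inv V [^] (k::nat) \<otimes> D [^] (q * int k)"

lemma E_carrier [simp]: "V \<in> carrier G \<Longrightarrow> E k V \<in> carrier G"
  by (simp add: E_def)

lemma inv_conjg_pow:
  assumes [simp]: "V \<in> carrier G" "x \<in> carrier G"
  shows "inv (cj V x) [^] (k::nat) = inv x \<otimes> (inv V [^] k \<otimes> x)"
  by (induction k) (simp_all add: conjg_def inv_mult_group m_assoc)

lemma terminal_in_P: "V \<in> S \<Longrightarrow> inv V \<otimes> D [^] q \<in> P"
  by (simp add: S_def prec_def)

lemma E_Suc:
  assumes [simp]: "V \<in> carrier G"
  shows "E (Suc k) V = E k V \<otimes> (D [^] (- (q * int k)) \<otimes> (inv V \<otimes> D [^] q \<otimes> D [^] (q * int k)))"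
  by (simp add: E_def m_assoc algebra_simps)

lemma E_in_P: "V \<in> S \<Longrightarrow> E k V \<in> P"
proof (induction k)
  case 0
  then show ?case by (simp add: E_def)
next
  case (Suc k)
  have [simp]: "V \<in> carrier G" using Suc.prems by (rule S_carrier)
  have "D [^] (- (q * int k)) \<otimes> (inv V \<otimes> D [^] q \<otimes> D [^] (q * int k)) \<in> P"
    using conj_D_pow_in_P_iff[of "inv V \<otimes> D [^] q" "q * int k"] terminal_in_P[OF Suc.prems] by simp
  then show ?case using Suc by (simp only: E_Suc \<open>V \<in> carrier G\<close> mult_in_P)
qed

text \<open>The right-hand side equals \<open>c \<otimes> E k (cj V c)\<close>, whose second factor
  is positive.\<close>

lemma le_E_mult_conj:
  assumes "V \<in> S" "c \<in> carrier G" "cj V c \<in> S"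
  shows "c \<preceq> E k V \<otimes> (D [^] (- (q * int k)) \<otimes> (c \<otimes> D [^] (q * int k)))"
proof -
  have [simp]: "V \<in> carrier G" using assms(1) by (rule S_carrier)
  have "c \<preceq> c \<otimes> E k (cj V c)" using assms by (intro le_mult_right E_in_P)
  also have "\<dots> = E k V \<otimes> (D [^] (- (q * int k)) \<otimes> (c \<otimes> D [^] (q * int k)))"
    using assms(2) by (simp add: E_def inv_conjg_pow m_assoc)
  finally show ?thesis .
qed

lemma glb_twist:
  assumes [simp]: "e \<in> carrier G" "a \<in> carrier G" "b \<in> carrier G"
  shows "glb (e \<otimes> (D [^] (- i :: int) \<otimes> (a \<otimes> D [^] i))) (e \<otimes> (D [^] (- i) \<otimes> (b \<otimes> D [^] i))) =
    e \<otimes> (D [^] (- i) \<otimes> (glb a b \<otimes> D [^] i))"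
  by (simp add: glb_mult_left glb_mult_D_pow)

text \<open>The meet of \<open>c\<close> with \<open>e = inv V \<otimes> D [^] q\<close> leads to
  \<open>U\<close>, so by minimality it is \<open>c\<close> or \<open>\<one>\<close>. In the second
  case \<open>c\<close> is below \<open>E k V\<close> times the twist of \<open>c\<close> and times
  the twist of \<open>e\<close>, hence below \<open>E k V\<close>, and \<open>k\<close>
  drops.\<close>

lemma umin_le_E:
  assumes V: "V \<in> U" and c: "umin V c"
  shows "c \<preceq> E k V \<Longrightarrow> c \<preceq> inv V \<otimes> D [^] q"
proof (induction k)
  case 0
  then show ?case using c le_one_imp by (auto simp: E_def umin_def)
next
  case (Suc k)
  have Vc [simp]: "V \<in> carrier G" using V by (rule U_carrier)
  have c': "c \<in> P" "cj V c \<in> U" using c by (auto simp: umin_def)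
  define e where "e = inv V \<otimes> D [^] q"
  have eP: "e \<in> P" unfolding e_def using V by (simp add: terminal_in_P U_imp_S)
  \<comment> \<open>As \<open>inv V\<close> commutes with \<open>V\<close>, the element
    \<open>e\<close> leads to \<open>U\<close> just as \<open>D [^] q\<close> does.\<close>
  have "cj V e = cj V (D [^] q)" by (simp add: e_def conjg_def inv_mult_group m_assoc)
  then have "cj V (glb c e) \<in> U"
    using V c' eP conjg_D_pow_in_U by (intro U_glb) simp_all
  then have "glb c e = \<one> \<or> glb c e = c"
    using c eP c'(1) glb_le1[of c e] by (simp add: umin_def)
  then show ?case
  proof
    assume "glb c e = c"
    then show ?thesis using glb_le2[of c e] eP c'(1) by (simp add: e_def)
  next
    assume g: "glb c e = \<one>"
    have "c \<preceq> E k V \<otimes> (D [^] (- (q * int k)) \<otimes> (glb c e \<otimes> D [^] (q * int k)))"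
      unfolding glb_twist[OF E_carrier[OF Vc] P_carrier[OF c'(1)] P_carrier[OF eP], symmetric]
    proof (rule le_glb)
      show "c \<preceq> E k V \<otimes> (D [^] (- (q * int k)) \<otimes> (c \<otimes> D [^] (q * int k)))"
        using V c' by (intro le_E_mult_conj) (simp_all add: U_imp_S)
      show "c \<preceq> E k V \<otimes> (D [^] (- (q * int k)) \<otimes> (e \<otimes> D [^] (q * int k)))"
        using Suc.prems unfolding e_def by (simp only: E_Suc Vc)
    qed
    then have "c \<preceq> E k V" by (simp add: g)
    then show ?thesis by (rule Suc.IH)
  qed
qed

lemma pow_inv_commute:
  assumes [simp]: "Y \<in> carrier G"
  shows "Y \<otimes> inv Y [^] (k::nat) = inv Y [^] k \<otimes> Y"
  by (induction k) (simp_all add: m_assoc[symmetric], simp add: m_assoc)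

text \<open>Writing \<open>E k Y = x \<otimes> e\<close>, a minimal \<open>c\<close> that is not grey is a prefix of \<open>e\<close> times the
  \<open>q * k\<close>-fold twist of the trivial meet, hence of \<open>e\<close> and so of \<open>E k (cj Y x)\<close>.\<close>

lemma grey_step:
  assumes Y: "Y \<in> U" and x: "x \<in> P" "cj Y x \<in> U" "x \<preceq> E k Y"
    and c: "umin (cj Y x) c" and triv: "glb (x \<otimes> c) (Y \<otimes> D [^] (- p)) = \<one>"
  shows "c \<preceq> inv (cj Y x) \<otimes> D [^] q"
proof (rule ccontr)
  assume not_grey: "\<not> c \<preceq> inv (cj Y x) \<otimes> D [^] q"
  define V where "V = cj Y x"
  define i where "i = q * int k"
  have Yc [simp]: "Y \<in> carrier G" using Y by (rule U_carrier)
  have xc [simp]: "x \<in> carrier G" using x by simp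
  have VU: "V \<in> U" using x by (simp add: V_def)
  have Vc [simp]: "V \<in> carrier G" using VU by (rule U_carrier)
  have c': "c \<in> P" "cj V c \<in> U" using c by (auto simp: umin_def V_def)
  have cc [simp]: "c \<in> carrier G" using c' by simp
  \<comment> \<open>By the dichotomy for minimal elements, an arrow that is not grey is
    black.\<close>
  have "c \<preceq> I V" using umin_black_or_grey[OF VU] c not_grey by (auto simp: V_def)
  then have cA: "c \<preceq> V \<otimes> D [^] (- p)" using I_le[OF Vc] by (rule le_trans)
  define e where "e = inv x \<otimes> E k Y"
  have eP: "e \<in> P" using x(3) by (simp add: e_def prec_def)
  have ec [simp]: "e \<in> carrier G" using eP by simp
  have pow: "inv V [^] k = inv x \<otimes> (inv Y [^] k \<otimes> x)" by (simp add: V_def inv_conjg_pow)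
  \<comment> \<open>Two bounds on \<open>c\<close> are sought, both \<open>e\<close> times a twist:
    here of \<open>x \<otimes> c\<close>, below of \<open>Y \<otimes> D [^] (- p)\<close>. Their
    meet involves only the trivial meet \<open>triv\<close>.\<close>
  have "c \<preceq> E k V \<otimes> (D [^] (- i) \<otimes> (c \<otimes> D [^] i))"
    unfolding i_def using VU c' by (intro le_E_mult_conj) (simp_all add: U_imp_S)
  also have "\<dots> = e \<otimes> (D [^] (- i) \<otimes> (x \<otimes> c \<otimes> D [^] i))"
    by (simp add: E_def e_def pow m_assoc i_def)
  finally have 1: "c \<preceq> e \<otimes> (D [^] (- i) \<otimes> (x \<otimes> c \<otimes> D [^] i))" .
  \<comment> \<open>Appending this positive factor to \<open>V \<otimes> D [^] (- p)\<close> lets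
    the inner powers of \<open>D\<close> and the inner \<open>x\<close> cancel, and \<open>Y\<close>
    then moves past the power of \<open>inv Y\<close>.\<close>
  have "D [^] p \<otimes> (e \<otimes> D [^] (- p)) \<in> P"
    using conj_D_pow_in_P_iff[of e "- p"] eP by simp
  then have "V \<otimes> D [^] (- p) \<preceq> V \<otimes> D [^] (- p) \<otimes> (D [^] p \<otimes> (e \<otimes> D [^] (- p)))"
    by (intro le_mult_right) simp_all
  with cA have "c \<preceq> V \<otimes> D [^] (- p) \<otimes> (D [^] p \<otimes> (e \<otimes> D [^] (- p)))" by (rule le_trans)
  also have "\<dots> = inv x \<otimes> (Y \<otimes> inv Y [^] k \<otimes> D [^] (i - p))"
    by (simp add: V_def conjg_def e_def E_def m_assoc i_def)
  also have "\<dots> = e \<otimes> (D [^] (- i) \<otimes> (Y \<otimes> D [^] (- p) \<otimes> D [^] i))"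
    unfolding pow_inv_commute[OF Yc] by (simp add: e_def E_def m_assoc i_def)
  finally have 2: "c \<preceq> e \<otimes> (D [^] (- i) \<otimes> (Y \<otimes> D [^] (- p) \<otimes> D [^] i))" .
  have "c \<preceq> e \<otimes> (D [^] (- i) \<otimes> (glb (x \<otimes> c) (Y \<otimes> D [^] (- p)) \<otimes> D [^] i))"
    using le_glb[OF 1 2] by (subst (asm) glb_twist) simp_all
  then have ce: "c \<preceq> e" by (simp add: triv)
  have "D [^] (- i) \<otimes> (x \<otimes> D [^] i) \<in> P" using x(1) conj_D_pow_in_P_iff by simp
  then have "e \<preceq> e \<otimes> (D [^] (- i) \<otimes> (x \<otimes> D [^] i))" by (intro le_mult_right) simp_all
  also have "\<dots> = E k V" by (simp add: e_def E_def pow m_assoc i_def)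
  finally have "c \<preceq> E k V" by (rule le_trans[OF ce])
  then show False using umin_le_E[OF VU] c not_grey by (auto simp: V_def)
qed

text \<open>This carries the invariant of the grey path over one more arrow;
  \<open>x \<otimes> inv (cj Y x) = inv Y \<otimes> x\<close> brings the bound on \<open>x\<close>
  into play.\<close>

lemma mult_le_E_Suc:
  assumes Y: "Y \<in> S" and x: "x \<in> P" "x \<preceq> E k Y" and c: "c \<preceq> inv (cj Y x) \<otimes> D [^] q"
  shows "x \<otimes> c \<preceq> E (Suc k) Y"
proof -
  have [simp]: "Y \<in> carrier G" using Y by (rule S_carrier)
  have [simp]: "x \<in> carrier G" using x(1) by simp
  have "x \<otimes> c \<preceq> x \<otimes> (inv (cj Y x) \<otimes> D [^] q)" using c by (intro le_mult_left) simp_all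
  also have "\<dots> = inv Y \<otimes> (x \<otimes> D [^] q)" by (simp add: conjg_def inv_mult_group m_assoc)
  also have "\<dots> \<preceq> inv Y \<otimes> (E k Y \<otimes> D [^] q)"
    using x(2) by (intro le_mult_left le_mult_D_pow) simp_all
  also have "\<dots> = E (Suc k) Y"
    unfolding E_def nat_pow_Suc2[OF inv_closed[OF \<open>Y \<in> carrier G\<close>]]
    by (simp add: m_assoc algebra_simps)
  finally show ?thesis .
qed

section \<open>Construction of the black and grey paths\<close>

abbreviation uarrow_black where "uarrow_black V s \<equiv> V \<in> U \<and> umin V s \<and> s \<preceq> I V"
abbreviation uarrow_grey where "uarrow_grey V s \<equiv> V \<in> U \<and> umin V s \<and> s \<preceq> inv V \<otimes> D [^] q"

text \<open>Conjugation by \<open>D\<close> permutes the finite set \<open>U\<close>, so some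
  positive power of \<open>D\<close> fixes every element of \<open>U\<close> under conjugation.
  Multiplying any conjugator by enough of it gives a positive one with the same end point.\<close>

lemma positive_conjugator_exists:
  assumes Y: "Y \<in> U" and Z: "Z \<in> U"
  obtains a where "a \<in> P" "Z = cj Y a"
proof -
  have Yc [simp]: "Y \<in> carrier G" and Zc [simp]: "Z \<in> carrier G"
    using Y Z by (simp_all add: U_carrier)
  obtain y z where yz [simp]: "y \<in> carrier G" "z \<in> carrier G" and eq: "Y = cj X y" "Z = cj X z"
    using Y Z by (auto simp: U_def S_def conjugates_def)
  have YZ: "Z = cj Y (inv y \<otimes> z)" unfolding eq(1) by (simp add: conjg_mult eq(2))
  have "finite U" using finite_S finite_subset[of U S] by (auto simp: U_def)
  moreover have "inj_on (\<lambda>V. cj V D) U"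
    by (rule inj_onI) (auto simp: conjg_def U_carrier)
  moreover have "(\<lambda>V. cj V D) ` U \<subseteq> U"
    using conjg_D_pow_in_U[of _ 1] by auto
  ultimately obtain N where N: "N > 0" "\<And>V k. V \<in> U \<Longrightarrow> ((\<lambda>V. cj V D) ^^ (N * k)) V = V"
    using finite_inj_self_map_periodic by blast
  have pow: "((\<lambda>V. cj V D) ^^ n) V = cj V (D [^] (int n))" if "V \<in> carrier G" for n V
    using that by (induction n) (simp_all add: conjg_mult add.commute)
  define w where "w = inv y \<otimes> z"
  have [simp]: "w \<in> carrier G" by (simp add: w_def)
  obtain k where k: "D [^] (- int k) \<preceq> w" using D_pow_bounds[of w] by auto
  have "D [^] (- int (N * k)) \<preceq> D [^] (- int k)"
    using N(1) by (intro D_pow_le_mono) (simp del: of_nat_mult)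
  then have "D [^] (- int (N * k)) \<preceq> w" using k by (rule le_trans)
  from le_mult_D_pow[OF this, of "int (N * k)"]
  have "w \<otimes> D [^] (int (N * k)) \<in> P" by (simp add: one_le_iff del: of_nat_mult)
  moreover have "Z = cj Y (w \<otimes> D [^] (int (N * k)))"
    using N(2)[OF Z, of k] pow[of Z "N * k"] YZ by (simp add: conjg_mult w_def del: of_nat_mult)
  ultimately show thesis by (rule that)
qed

text \<open>The end condition of \<open>path_by\<close> refers to \<open>USS\<close>, whereas the
  arrows here are built over \<open>U\<close>.\<close>

context
  assumes USS_eq: "USS G P D X = U"
begin

text \<open>As long as the remaining conjugator meets the initial factor nontrivially, that meet
  leads to \<open>U\<close> and has a minimal prefix to strip off; the shrinking remainder ends the
  process.\<close>

lemma black_path_exists: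
  assumes "a \<in> P" "V \<in> U" "cj V a \<in> U"
  shows "\<exists>bs x h. path_by uarrow_black G P D X V bs (cj V x) \<and> foldr (\<otimes>) bs \<one> = x \<and>
    x \<in> P \<and> h \<in> P \<and> a = x \<otimes> h \<and> cj V x \<in> U \<and> glb h (I (cj V x)) = \<one>"
  using assms
proof (induction a arbitrary: V rule: positive_factor_induct)
  case (factor a)
  have Vc [simp]: "V \<in> carrier G" using factor.prems(1) by (rule U_carrier)
  have aP: "a \<in> P" by (rule factor.hyps)
  show ?case
  proof (cases "glb a (I V) = \<one>")
    case True
    then show ?thesis using factor.prems aP
      by (intro exI[of _ "[]"] exI[of _ \<one>] exI[of _ a]) (simp add: USS_eq)
  next
    case False
    have IP: "I V \<in> P" using factor.prems(1) by (simp add: I_in_P U_imp_S)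
    have "cj V (I V) \<in> U" using C_in_U[OF factor.prems(1)] by (simp add: C_def)
    then have "cj V (glb a (I V)) \<in> U" using factor.prems aP IP by (intro U_glb)
    then obtain s where s: "umin V s" "s \<preceq> glb a (I V)"
      using umin_exists[OF factor.prems(1) _ False] aP IP by auto
    have sa: "s \<preceq> a" using s(2) by (rule le_trans) (simp add: glb_le1 aP)
    have sI: "s \<preceq> I V" using s(2) by (rule le_trans) (simp add: glb_le2 aP)
    have s': "s \<in> P" "s \<noteq> \<one>" "cj V s \<in> U" using s(1) by (auto simp: umin_def)
    define b where "b = inv s \<otimes> a"
    have bP: "b \<in> P" using sa by (simp add: b_def prec_def)
    have ab: "a = s \<otimes> b" using aP s' by (simp add: b_def)
    have "cj (cj V s) b \<in> U" using factor.prems(2) ab s' bP by (simp add: conjg_mult)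
    from factor.IH(2)[OF s'(1) bP s'(2) ab s'(3) this]
    obtain bs x h where h: "path_by uarrow_black G P D X (cj V s) bs (cj (cj V s) x)"
        "foldr (\<otimes>) bs \<one> = x" "x \<in> P" "h \<in> P" "b = x \<otimes> h" "cj (cj V s) x \<in> U"
        "glb h (I (cj (cj V s) x)) = \<one>" by blast
    have eq: "cj (cj V s) x = cj V (s \<otimes> x)" using s' h by (simp add: conjg_mult)
    show ?thesis
      using h factor.prems(1) s(1) sI s'(1) ab unfolding eq
      by (intro exI[of _ "s # bs"] exI[of _ "s \<otimes> x"] exI[of _ h]) (simp add: m_assoc)
  qed
qed

text \<open>The base point \<open>Y\<close> stays fixed, because the trivial meet is known only
  there. The induction moves the split \<open>a = x \<otimes> h\<close>, with \<open>x\<close> the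
  part already travelled and \<open>k\<close> raised by one for each grey arrow.\<close>

lemma grey_path_exists:
  assumes Y: "Y \<in> U" and a: "a \<in> P" "cj Y a \<in> U" "glb a (Y \<otimes> D [^] (- p)) = \<one>"
    and "h \<in> P" "x \<in> P" "a = x \<otimes> h" "x \<preceq> E k Y" "cj Y x \<in> U"
  shows "\<exists>gs. path_by uarrow_grey G P D X (cj Y x) gs (cj Y a) \<and> foldr (\<otimes>) gs \<one> = h"
  using assms(5-)
proof (induction h arbitrary: x k rule: positive_factor_induct)
  case (factor h)
  have Yc [simp]: "Y \<in> carrier G" using Y by (rule U_carrier)
  have xc [simp]: "x \<in> carrier G" using factor.prems(1) by simp
  have hP: "h \<in> P" by (rule factor.hyps)
  show ?case
  proof (cases "h = \<one>")
    case True
    then show ?thesis using factor.prems by (intro exI[of _ "[]"]) (simp add: USS_eq)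
  next
    case False
    have "cj (cj Y x) h \<in> U" using a(2) factor.prems(2) hP by (simp add: conjg_mult)
    then obtain c where c: "umin (cj Y x) c" "c \<preceq> h"
      using umin_exists[OF factor.prems(4) hP False] by blast
    have c': "c \<in> P" "c \<noteq> \<one>" "cj (cj Y x) c \<in> U" using c(1) by (auto simp: umin_def)
    have [simp]: "c \<in> carrier G" using c' by simp
    define b where "b = inv c \<otimes> h"
    have bP: "b \<in> P" using c(2) by (simp add: b_def prec_def)
    have hb: "h = c \<otimes> b" using hP c' by (simp add: b_def)
    have ab: "a = (x \<otimes> c) \<otimes> b" using factor.prems(2) hb bP by (simp add: m_assoc)
    have AP: "Y \<otimes> D [^] (- p) \<in> P" using Y by (simp add: initial_in_P U_imp_S)
    have "x \<otimes> c \<preceq> a" unfolding ab using bP by (intro le_mult_right) simp_all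
    then have "glb (x \<otimes> c) (Y \<otimes> D [^] (- p)) \<preceq> glb a (Y \<otimes> D [^] (- p))"
      by (intro le_glb le_trans[OF glb_le1] glb_le2) simp_all
    then have "glb (x \<otimes> c) (Y \<otimes> D [^] (- p)) = \<one>"
      using a(3) factor.prems(1) c'(1) AP by (intro le_one_imp) simp_all
    with grey_step[OF Y factor.prems(1,4,3) c(1)]
    have grey: "c \<preceq> inv (cj Y x) \<otimes> D [^] q" by simp
    have "x \<otimes> c \<preceq> E (Suc k) Y"
      using Y factor.prems(1,3) grey by (intro mult_le_E_Suc) (simp_all add: U_imp_S)
    moreover have "x \<otimes> c \<in> P" using factor.prems(1) c'(1) by simp
    moreover have "cj Y (x \<otimes> c) \<in> U" using c'(3) by (simp add: conjg_mult)
    ultimately obtain gs where gs: "path_by uarrow_grey G P D X (cj Y (x \<otimes> c)) gs (cj Y a)"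
        "foldr (\<otimes>) gs \<one> = b"
      using factor.IH(2)[OF c'(1) bP c'(2) hb _ ab] by blast
    then show ?thesis
      using factor.prems(4) c(1) grey hb
      by (intro exI[of _ "c # gs"]) (simp add: conjg_mult)
  qed
qed

lemma black_grey_path_exists:
  assumes "Y \<in> U" "a \<in> P" "cj Y a \<in> U"
  shows "\<exists>bs gs W. path_by uarrow_black G P D X Y bs W \<and>
    path_by uarrow_grey G P D X W gs (cj Y a) \<and> foldr (\<otimes>) (bs @ gs) \<one> = a"
proof -
  have [simp]: "Y \<in> carrier G" using assms(1) by (rule U_carrier)
  obtain bs x h where h: "path_by uarrow_black G P D X Y bs (cj Y x)"
      "foldr (\<otimes>) bs \<one> = x" "x \<in> P" "h \<in> P" "a = x \<otimes> h" "cj Y x \<in> U" "glb h (I (cj Y x)) = \<one>"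
    using black_path_exists[OF assms(2,1,3)] by blast
  define W where "W = cj Y x"
  have W: "W \<in> U" using h(6) by (simp add: W_def)
  have [simp]: "W \<in> carrier G" using W by (rule U_carrier)
  have Wh: "cj W h = cj Y a" using h by (simp add: W_def conjg_mult)
  have AP: "W \<otimes> D [^] (- p) \<in> P" using W by (simp add: initial_in_P U_imp_S)
  \<comment> \<open>The black part yields a trivial meet with \<open>I W\<close> only; a nontrivial
    common prefix here would have a nontrivial simple part, which lies below
    \<open>I W\<close>.\<close>
  have "glb h (W \<otimes> D [^] (- p)) = \<one>"
  proof (rule ccontr)
    let ?g = "glb h (W \<otimes> D [^] (- p))"
    assume ne: "?g \<noteq> \<one>"
    have gP: "?g \<in> P" using h(4) AP by simp
    have "glb ?g D \<preceq> ?g" using gP by (intro glb_le1) simp_all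
    then have "glb ?g D \<preceq> h" "glb ?g D \<preceq> W \<otimes> D [^] (- p)"
      using h(4) by (auto intro: le_trans[OF _ glb_le1] le_trans[OF _ glb_le2])
    then have "glb ?g D \<preceq> glb h (I W)"
      unfolding I_def using gP by (intro le_glb glb_le2) simp_all
    then have "glb ?g D = \<one>" using h(7) gP by (intro le_one_imp) (simp_all add: W_def)
    then show False using glb_D_nontrivial[OF gP ne] by simp
  qed
  moreover have "\<one> \<preceq> E 0 W" by (simp add: E_def)
  ultimately obtain gs where gs: "path_by uarrow_grey G P D X (cj W \<one>) gs (cj W h)"
      "foldr (\<otimes>) gs \<one> = h"
    using grey_path_exists[OF W h(4), of h \<one> 0] h(4) W assms(3) by (auto simp: Wh)
  have "foldr (\<otimes>) (bs @ gs) \<one> = a"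
  proof -
    have "path_by uarrow_black G P D X V bs V' \<Longrightarrow> set bs \<subseteq> P" for V V'
      by (induction bs arbitrary: V) (auto simp: umin_def)
    then have "set bs \<subseteq> P" using h(1) by blast
    then have "foldr (\<otimes>) bs y = foldr (\<otimes>) bs \<one> \<otimes> y \<and> foldr (\<otimes>) bs \<one> \<in> carrier G"
      if "y \<in> carrier G" for y
      using that by (induction bs) (auto simp: m_assoc)
    then show ?thesis using h gs by simp
  qed
  then show ?thesis using h(1) gs W unfolding W_def[symmetric] Wh by auto
qed

end

end

subsection \<open>Infimum, supremum and initial factor\<close>

lemma int_bounded_max_exists:
  fixes Q :: "int \<Rightarrow> bool"
  assumes "Q a" "\<And>i. Q i \<Longrightarrow> i \<le> b"
  shows "\<exists>m. Q m \<and> (\<forall>i. Q i \<longrightarrow> i \<le> m)"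
proof -
  let ?T = "{i \<in> {a..b}. Q i}"
  have fin: "finite ?T" by (rule finite_subset[of _ "{a..b}"]) auto
  have a: "a \<in> ?T" using assms by auto
  have "Max ?T \<in> ?T" using fin a by (intro Max_in) auto
  moreover have "i \<le> Max ?T" if "Q i" for i
  proof (cases "a \<le> i")
    case True
    then show ?thesis using fin that assms(2)[OF that] by (intro Max_ge) auto
  next
    case False
    then show ?thesis using Max_ge[OF fin a] by simp
  qed
  ultimately show ?thesis by blast
qed

context garside_group
begin

text \<open>If \<open>D = \<one>\<close> then neither the greatest nor the least integer exists, and both choices fall
  back to the same junk value.\<close>

lemma glen_pos_imp_D_ne_one:
  assumes "glen G P D V > 0"
  shows "D \<noteq> \<one>"
proof
  assume "D = \<one>"
  have no_max_min: "(Q \<and> (Q \<longrightarrow> (\<forall>y. y \<le> x))) = False" "(Q \<and> (Q \<longrightarrow> (\<forall>y. x \<le> y))) = False"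
    for Q and x :: int
    using gt_ex[of x] lt_ex[of x] by (auto simp: not_le)
  have "ginf G P D V = gsup G P D V"
    using \<open>D = \<one>\<close> by (simp add: ginf_def gsup_def Greatest_def Least_def no_max_min)
  then show False using assms by (simp add: glen_def)
qed

context
  assumes D_ne_one: "D \<noteq> \<one>"
begin

lemma D_pow_le_imp:
  assumes "D [^] (i::int) \<preceq> D [^] (j::int)"
  shows "i \<le> j"
proof (rule ccontr)
  assume "\<not> i \<le> j"
  then have "D [^] j \<preceq> D [^] (i - 1)" by (intro D_pow_le_mono) simp
  with assms have "D [^] i \<preceq> D [^] (i - 1)" by (rule le_trans)
  from le_mult_D_pow[OF this, of "1 - i"] have "D \<preceq> \<one>" by simp
  then show False using D_ne_one le_one_imp by simp
qed

text \<open>An upper bound \<open>D [^] n\<close> for \<open>V\<close> bounds the exponents because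
  \<open>D \<noteq> \<one>\<close>, so the \<open>GREATEST\<close> in \<open>ginf\<close> is
  attained.\<close>

lemma D_pow_le_iff_ginf:
  assumes V: "V \<in> carrier G"
  shows "D [^] (i::int) \<preceq> V \<longleftrightarrow> i \<le> ginf G P D V"
proof -
  obtain n where n: "D [^] (- int n) \<preceq> V" "V \<preceq> D [^] (int n)"
    using D_pow_bounds[OF V] by blast
  have "i \<le> int n" if "D [^] i \<preceq> V" for i :: int
    using le_trans[OF that n(2)] by (rule D_pow_le_imp)
  then obtain m where m: "D [^] m \<preceq> V" "\<And>i::int. D [^] i \<preceq> V \<Longrightarrow> i \<le> m"
    using int_bounded_max_exists[of "\<lambda>i. D [^] i \<preceq> V", OF n(1)] by blast
  have "ginf G P D V = m"
    unfolding ginf_def by (rule Greatest_equality) (use m in auto)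
  then show ?thesis using m D_pow_le_mono le_trans by metis
qed

lemma le_D_pow_iff_inv:
  "V \<in> carrier G \<Longrightarrow> V \<preceq> D [^] (i::int) \<longleftrightarrow> D [^] (- i) \<preceq> inv V"
  using conj_P_shift[of "inv V" "- i"] by (simp add: prec_def)

lemma gsup_eq:
  assumes V: "V \<in> carrier G"
  shows "gsup G P D V = - ginf G P D (inv V)"
  unfolding gsup_def
  by (rule Least_equality) (simp_all add: V le_D_pow_iff_inv D_pow_le_iff_ginf)

lemma le_D_pow_iff_gsup:
  "V \<in> carrier G \<Longrightarrow> V \<preceq> D [^] (i::int) \<longleftrightarrow> gsup G P D V \<le> i"
  by (auto simp: gsup_eq le_D_pow_iff_inv D_pow_le_iff_ginf)

text \<open>The maximal simple prefix is a meet with \<open>D\<close>. Conjugation by a power of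
  \<open>D\<close> respects meets and fixes \<open>D\<close>, so it only moves the power of
  \<open>D\<close> from the left of \<open>V\<close> to the right.\<close>

lemma iota_eq:
  assumes V: "V \<in> carrier G" and len: "glen G P D V > 0"
  shows "iota G P D V = glb (V \<otimes> D [^] (- ginf G P D V)) D"
proof -
  define p where "p = ginf G P D V"
  define W where "W = D [^] (- p) \<otimes> V"
  have "D [^] p \<preceq> V" using V by (simp add: D_pow_le_iff_ginf p_def)
  then have WP: "W \<in> P" by (simp add: W_def prec_def)
  have "max_simple_prefix G P D W = glb W D"
    unfolding max_simple_prefix_def
  proof (rule the_equality)
    show "glb W D \<in> simples G P D \<and> glb W D \<preceq> W \<and>
        (\<forall>t. t \<in> simples G P D \<and> t \<preceq> W \<longrightarrow> t \<preceq> glb W D)"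
      using WP by (auto simp: simples_def one_le_iff glb_le1 glb_le2 intro: le_glb)
    then show "s = glb W D" if "s \<in> simples G P D \<and> s \<preceq> W \<and>
        (\<forall>t. t \<in> simples G P D \<and> t \<preceq> W \<longrightarrow> t \<preceq> s)" for s
      using that by (auto intro: le_antisym)
  qed
  then have "iota G P D V = D [^] p \<otimes> (glb W D \<otimes> D [^] (- p))"
    using len WP by (simp add: iota_def Let_def p_def[symmetric] W_def[symmetric] m_assoc)
  also have "\<dots> = glb (D [^] p \<otimes> (W \<otimes> D [^] (- p))) (D [^] p \<otimes> (D \<otimes> D [^] (- p)))"
    using WP by (simp add: glb_mult_left glb_mult_D_pow del: D_mult_pow)
  also have "\<dots> = glb (V \<otimes> D [^] (- p)) D"
    using V by (simp add: W_def m_assoc)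
  finally show ?thesis by (simp add: p_def)
qed

end

end

section \<open>Passage from \<open>S\<close>, \<open>U\<close> and \<open>umin\<close> to
  \<open>SSS\<close>, \<open>USS\<close> and coloured arrows\<close>

lemma path_by_mono:
  assumes "path_by A G P D X Y ss Z" "\<And>V s. A V s \<Longrightarrow> B V s"
  shows "path_by B G P D X Y ss Z"
  using assms(1) by (induction ss arbitrary: Y) (auto simp: assms(2))

theorem mainTheorem10:
  fixes G :: "('a,'b) monoid_scheme" and P :: "'a set" and D X Y Z :: 'a
  assumes "garside G P D"
    and "X \<in> carrier G"
    and "Y \<in> USS G P D X" and "Z \<in> USS G P D X"
    and "glen G P D Y > 0"
  shows "(\<exists>bs gs W. black_path G P D X Y bs W \<and> grey_path G P D X W gs Z) \<and>
         (\<forall>\<alpha>\<in>P. Z = conjg G Y \<alpha> \<longrightarrow>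
            (\<exists>bs gs W. black_path G P D X Y bs W \<and> grey_path G P D X W gs Z \<and>
               foldr (\<otimes>\<^bsub>G\<^esub>) (bs @ gs) \<one>\<^bsub>G\<^esub> = \<alpha>))"
proof -
  \<comment> \<open>Since \<open>Y\<close> lies in \<open>SSS\<close>, these are the extremal
    infimum and supremum within the conjugacy class.\<close>
  define p where "p = ginf G P D Y"
  define q where "q = gsup G P D Y"
  interpret garside_summit G P D X p q
  proof unfold_locales
    show "garside G P D" by (rule assms(1))
    show "X \<in> carrier G" by (rule assms(2))
    show "p < q" using assms(5) by (simp add: glen_def p_def q_def)
  qed
  have D_ne: "D \<noteq> \<one>\<^bsub>G\<^esub>" using assms(5) by (rule glen_pos_imp_D_ne_one)
  have conj_carrier: "V \<in> carrier G" if "V \<in> conjugates G X" for V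
    using that by (auto simp: conjugates_def)
  have Y: "Y \<in> conjugates G X"
      "\<And>V. V \<in> conjugates G X \<Longrightarrow> ginf G P D V \<le> p \<and> q \<le> gsup G P D V"
    using assms(3) by (auto simp: USS_def SSS_def p_def q_def)
  have S_iff: "V \<in> S \<longleftrightarrow> V \<in> conjugates G X \<and> p \<le> ginf G P D V \<and> gsup G P D V \<le> q" for V
    using conj_carrier[of V] by (auto simp: S_def D_pow_le_iff_ginf[OF D_ne] le_D_pow_iff_gsup[OF D_ne])
  \<comment> \<open>Extremality of \<open>Y\<close> turns the bounds defining \<open>S\<close> into
    equalities.\<close>
  have inf_sup: "ginf G P D V = p" "gsup G P D V = q" if "V \<in> S" for V
    using that Y(2)[of V] by (auto simp: S_iff)
  have SSS_eq: "SSS G P D X = S"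
  proof
    show "SSS G P D X \<subseteq> S"
    proof
      fix V assume "V \<in> SSS G P D X"
      then have "V \<in> conjugates G X" "p \<le> ginf G P D V" "gsup G P D V \<le> q"
        using Y(1) unfolding SSS_def p_def q_def by blast+
      then show "V \<in> S" by (simp add: S_iff)
    qed
    show "S \<subseteq> SSS G P D X" using Y(2) by (fastforce simp: SSS_def S_iff)
  qed
  \<comment> \<open>On \<open>S\<close> the length is \<open>q - p > 0\<close>, so
    \<open>iota\<close> never takes its default value \<open>\<one>\<close>.\<close>
  have iota_I: "iota G P D V = I V" if "V \<in> S" for V
    using iota_eq[OF D_ne S_carrier[OF that]] inf_sup[OF that] p_less_q by (simp add: I_def glen_def)
  have "(cycling G P D ^^ m) V = (C ^^ m) V \<and> (C ^^ m) V \<in> S" if "V \<in> S" for V m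
    using that by (induction m) (simp_all add: cycling_def C_def[symmetric] iota_I C_in_S)
  then have USS_U: "USS G P D X = U" by (auto simp: USS_def U_def SSS_eq)
  have minimal: "minimal_simple G P D X V s" if "umin V s" for V s
    using that unfolding minimal_simple_def umin_def simples_def USS_U one_le_iff by blast
  have black: "black_arrow G P D X V s" if "V \<in> U \<and> umin V s \<and> prec G P s (I V)" for V s
    using that minimal by (simp add: black_arrow_def arrow_def USS_U iota_I U_imp_S)
  have grey: "grey_arrow G P D X V s"
    if h: "V \<in> U \<and> umin V s \<and> prec G P s (inv\<^bsub>G\<^esub> V \<otimes>\<^bsub>G\<^esub> D [^]\<^bsub>G\<^esub> q)" for V s
  proof -
    have VS: "V \<in> S" using h by (simp add: U_imp_S)
    have Vc: "V \<in> carrier G" using VS by (rule S_carrier)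
    \<comment> \<open>Inversion exchanges infimum and supremum up to sign, so the initial factor of
      the inverse is the simple part of \<open>inv V \<otimes> D [^] q\<close>; for simple
      \<open>s\<close> the two grey conditions then agree.\<close>
    have "ginf G P D (inv\<^bsub>G\<^esub> V) = - q" "gsup G P D (inv\<^bsub>G\<^esub> V) = - p"
      using gsup_eq[OF D_ne Vc] gsup_eq[OF D_ne inv_closed[OF Vc]] inf_sup[OF VS] Vc by simp_all
    then have "iota G P D (inv\<^bsub>G\<^esub> V) = glb (inv\<^bsub>G\<^esub> V \<otimes>\<^bsub>G\<^esub> D [^]\<^bsub>G\<^esub> q) D"
      using iota_eq[OF D_ne inv_closed[OF Vc]] p_less_q by (simp add: glen_def)
    moreover have "prec G P s D" using h by (simp add: umin_def)
    ultimately show ?thesis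
      using h minimal by (auto simp: grey_arrow_def arrow_def USS_U intro: le_glb)
  qed
  have path: "\<exists>bs gs W. black_path G P D X Y bs W \<and> grey_path G P D X W gs Z \<and>
      foldr (\<otimes>\<^bsub>G\<^esub>) (bs @ gs) \<one>\<^bsub>G\<^esub> = \<alpha>" if \<alpha>: "\<alpha> \<in> P" "Z = conjg G Y \<alpha>" for \<alpha>
  proof -
    have "Y \<in> U" "conjg G Y \<alpha> \<in> U" using assms(3,4) \<alpha>(2) by (simp_all add: USS_U)
    then obtain bs gs W where h: "path_by uarrow_black G P D X Y bs W"
        "path_by uarrow_grey G P D X W gs Z" "foldr (\<otimes>\<^bsub>G\<^esub>) (bs @ gs) \<one>\<^bsub>G\<^esub> = \<alpha>"
      using black_grey_path_exists[OF USS_U _ \<alpha>(1)] \<alpha>(2) by blast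
    have "black_path G P D X Y bs W"
      unfolding black_path_def using h(1) black by (rule path_by_mono)
    moreover have "grey_path G P D X W gs Z"
      unfolding grey_path_def using h(2) grey by (rule path_by_mono)
    ultimately show ?thesis using h(3) by blast
  qed
  \<comment> \<open>The first claim reduces to the second through some positive conjugator.\<close>
  obtain a where "a \<in> P" "Z = conjg G Y a"
    using positive_conjugator_exists assms(3,4) USS_U by blast
  then show ?thesis using path by blast
qed

end
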